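(* Let $p,q\ge 0$ be integers with $n=p+q\ge 1$. Consider the subsets (Lie groups) of $\mathbb{C}\otimes C\!\ell_{p,q}$ \[ G^{2i1}_{p,q}=\{U\in C\!\ell^{(0)}_{p,q}\oplus iC\!\ell^{(1)}_{p,q}: U^\ddagger U=e\},\quad G^{2i3}_{p,q}=\{U\in C\!\ell^{(0)}_{p,q}\oplus iC\!\ell^{(1)}_{p,q}: \hat U^{\ddagger} U=e\}, \] \[ G^{23}_{p,q}=\{U\in C\!\ell_{p,q}: \tilde U U=e\},\quad G^{12}_{p,q}=\{U\in C\!\ell_{p,q}: \tilde{\hat U} U=e\},\quad G^{2}_{p,q}=\{U\in C\!\ell^{(0)}_{p,q}: \tilde U U=e\}. \] Then the following Lie group isomorphisms hold. (i) If $p-q\equiv 3$ or $7 \pmod 8$ (so $n$ is odd): $G^{23}_{p,q}\cong \mathrm{U}(2^{\frac{n-1}{2}})$ if $(p,q)=(n,0)$; $G^{23}_{p,q}\cong \mathrm{U}(2^{\frac{n-3}{2}},2^{\frac{n-3}{2}})$ if $n\equiv 3,7\pmod 8$ and $q\ne 0$; $G^{23}_{p,q}\cong \mathrm{Sp}(2^{\frac{n-3}{2}},\mathbb{C})$ if $n\equiv 5\pmod 8$; $G^{23}_{p,q}\cong \mathrm{O}(2^{\frac{n-1}{2}},\mathbb{C})$ if $n\equiv 1\pmod 8$. (ii) If $p-q\equiv 3$ or $7\pmod 8$: $G^{12}_{p,q}\cong \mathrm{U}(2^{\frac{n-1}{2}})$ if $(p,q)=(0,n)$; $G^{12}_{p,q}\cong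 \mathrm{U}(2^{\frac{n-3}{2}},2^{\frac{n-3}{2}})$ if $n\equiv 1,5\pmod 8$ and $p\ne 0$; $G^{12}_{p,q}\cong \mathrm{Sp}(2^{\frac{n-3}{2}},\mathbb{C})$ if $n\equiv 3\pmod 8$; $G^{12}_{p,q}\cong \mathrm{O}(2^{\frac{n-1}{2}},\mathbb{C})$ if $n\equiv 7\pmod 8$. (iii) If $p-q\equiv 1$ or $5\pmod 8$ (so $n$ is odd): $G^{2i1}_{p,q}\cong \mathrm{U}(2^{\frac{n-1}{2}})$ if $(p,q)=(n,0)$; $G^{2i1}_{p,q}\cong \mathrm{U}(2^{\frac{n-3}{2}},2^{\frac{n-3}{2}})$ if $n\equiv 1,5\pmod 8$ and $q\ne 0$; $G^{2i1}_{p,q}\cong \mathrm{Sp}(2^{\frac{n-3}{2}},\mathbb{C})$ if $n\equiv 3\pmod 8$; $G^{2i1}_{p,q}\cong \mathrm{O}(2^{\frac{n-1}{2}},\mathbb{C})$ if $n\equiv 7\pmod 8$. (iv) If $p-q\equiv 1$ or $5\pmod 8$: $G^{2i3}_{p,q}\cong \mathrm{U}(2^{\frac{n-1}{2}})$ if $(p,q)=(0,n)$; $G^{2i3}_{p,q}\cong \mathrm{U}(2^{\frac{n-3}{2}},2^{\frac{n-3}{2}})$ if $n\equiv 3,7\pmod 8$ and $p\ne 0$; $G^{2i3}_{p,q}\cong \mathrm{Sp}(2^{\frac{n-3}{2}},\mathbb{C})$ if $n\equiv 5\pmod 8$; $G^{2i3}_{p,q}\cong \mathrm{O}(2^{\frac{n-1}{2}},\mathbb{C})$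 if $n\equiv 1\pmod 8$. (v) If $p-q\equiv 2$ or $6\pmod 8$ (so $n$ is even): $G^{2}_{p,q}\cong \mathrm{U}(2^{\frac{n-2}{2}})$ if $(p,q)=(n,0)$ or $(p,q)=(0,n)$; $G^{2}_{p,q}\cong \mathrm{U}(2^{\frac{n-4}{2}},2^{\frac{n-4}{2}})$ if $n\equiv 2,6\pmod 8$ and $p,q\ne 0$; $G^{2}_{p,q}\cong \mathrm{Sp}(2^{\frac{n-4}{2}},\mathbb{C})$ if $n\equiv 4\pmod 8$; $G^{2}_{p,q}\cong \mathrm{O}(2^{\frac{n-2}{2}},\mathbb{C})$ if $n\equiv 0\pmod 8$.
   Context: $C\!\ell_{p,q}$ is the real Clifford algebra with identity $e$ and generators $e^1,\dots,e^n$ ($n=p+q$) satisfying $e^ae^b+e^be^a=2\eta^{ab}e$, where $\eta=\mathrm{diag}(1,\dots,1,-1,\dots,-1)$ with $p$ entries $+1$ and $q$ entries $-1$; the elements $e$ and $e^{a_1\dots a_k}=e^{a_1}\cdots e^{a_k}$ ($a_1<\dots<a_k$) form a basis. $\mathbb{C}\otimes C\!\ell_{p,q}$ is its complexification (same basis, complex coefficients). $C\!\ell^k_{p,q}$ is the span of basis elements of grade $k$; $C\!\ell^{(0)}_{p,q}=\bigoplus_{k \text{ even}}C\!\ell^k_{p,q}$, $C\!\ell^{(1)}_{p,q}=\bigoplus_{k\text{ odd}}C\!\ell^k_{p,q}$. The grade involution $U\mapsto \hat U$ replaces each $e^a$ by $-e^a$; the reversion $U\mapsto\tilde U$ is the linear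 map sending $e^{a_1\dots a_r}$ to $e^{a_r}\cdots e^{a_1}$; complex conjugation $U\mapsto \bar U$ conjugates all complex coefficients in the basis expansion; $U^\ddagger=\tilde{\bar U}$ (pseudo-Hermitian conjugation). Classical groups: $\mathrm{U}(m)=\{A\in\mathrm{Mat}(m,\mathbb{C}):A^\dagger A=\mathbf 1\}$; $\mathrm{U}(r,s)=\{A\in \mathrm{Mat}(r+s,\mathbb{C}):A^\dagger\eta_{r,s}A=\eta_{r,s}\}$ with $\eta_{r,s}=\mathrm{diag}(1,\dots,1,-1,\dots,-1)$ ($r$ ones, $s$ minus ones); $\mathrm{Sp}(m,\mathbb{C})=\{A\in\mathrm{Mat}(2m,\mathbb{C}):A^T\Omega A=\Omega\}$ with $\Omega=\begin{pmatrix}0&-\mathbf 1\\ \mathbf 1&0\end{pmatrix}$; $\mathrm{O}(m,\mathbb{C})=\{A\in \mathrm{Mat}(m,\mathbb{C}):A^TA=\mathbf 1\}$. *)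

theory Defs
  imports "HOL-Analysis.Analysis"
begin

text \<open>An element of C (x) Cl_{p,q}, n = p+q, is represented by its coordinates with respect to
the basis e_A (A a subset of {0..<n}, listing generator indices in increasing order; e_{} = e).
Generator indices a < p square to +e, indices p <= a < p+q square to -e.
Coordinates outside Pow {0..<n} are required to vanish (see cl_carrier).
The function space carries the product topology, which on cl_carrier n is the
usual Euclidean topology of the finite-dimensional algebra.\<close>

type_synonym clif = "nat set \<Rightarrow> complex"

definition cl_carrier :: "nat \<Rightarrow> clif set" where
  "cl_carrier n = {U. \<forall>A. \<not> A \<subseteq> {..<n} \<longrightarrow> U A = 0}"

definition eta_sq :: "nat \<Rightarrow> nat \<Rightarrow> complex" where
  "eta_sq p a = (if a < p then 1 else -1)"

text \<open>e_A e_B = blade_sign p A B * e_{A symmetric-difference B}\<close>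
definition blade_sign :: "nat \<Rightarrow> nat set \<Rightarrow> nat set \<Rightarrow> complex" where
  "blade_sign p A B =
     (-1) ^ card {(a, b). a \<in> A \<and> b \<in> B \<and> b < a} * (\<Prod>a\<in>A \<inter> B. eta_sq p a)"

definition symdiff :: "nat set \<Rightarrow> nat set \<Rightarrow> nat set" where
  "symdiff A B = (A - B) \<union> (B - A)"

definition cl_mult :: "nat \<Rightarrow> nat \<Rightarrow> clif \<Rightarrow> clif \<Rightarrow> clif" where
  "cl_mult p q U V = (\<lambda>C. if C \<subseteq> {..<p+q}
      then (\<Sum>A\<in>Pow {..<p+q}. U A * V (symdiff A C) * blade_sign p A (symdiff A C))
      else 0)"

definition cl_one :: clif where
  "cl_one = (\<lambda>A. if A = {} then 1 else 0)"

definition cl_hat :: "clif \<Rightarrow> clif" where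
  "cl_hat U = (\<lambda>A. (-1) ^ card A * U A)"

definition cl_rev :: "clif \<Rightarrow> clif" where
  "cl_rev U = (\<lambda>A. (-1) ^ (card A * (card A - 1) div 2) * U A)"

definition cl_cnj :: "clif \<Rightarrow> clif" where
  "cl_cnj U = (\<lambda>A. cnj (U A))"

definition cl_dagger :: "clif \<Rightarrow> clif" where
  "cl_dagger U = cl_rev (cl_cnj U)"

definition cl_real :: "nat \<Rightarrow> nat \<Rightarrow> clif set" where
  "cl_real p q = {U \<in> cl_carrier (p+q). \<forall>A. U A \<in> \<real>}"

definition cl_even :: "nat \<Rightarrow> nat \<Rightarrow> clif set" where
  "cl_even p q = {U \<in> cl_real p q. \<forall>A. odd (card A) \<longrightarrow> U A = 0}"

definition cl_even_i_odd :: "nat \<Rightarrow> nat \<Rightarrow> clif set" where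
  "cl_even_i_odd p q = {U \<in> cl_carrier (p+q).
      \<forall>A. (even (card A) \<longrightarrow> U A \<in> \<real>) \<and> (odd (card A) \<longrightarrow> Re (U A) = 0)}"

definition G2i1 :: "nat \<Rightarrow> nat \<Rightarrow> clif set" where
  "G2i1 p q = {U \<in> cl_even_i_odd p q. cl_mult p q (cl_dagger U) U = cl_one}"

definition G2i3 :: "nat \<Rightarrow> nat \<Rightarrow> clif set" where
  "G2i3 p q = {U \<in> cl_even_i_odd p q. cl_mult p q (cl_dagger (cl_hat U)) U = cl_one}"

definition G23 :: "nat \<Rightarrow> nat \<Rightarrow> clif set" where
  "G23 p q = {U \<in> cl_real p q. cl_mult p q (cl_rev U) U = cl_one}"

definition G12 :: "nat \<Rightarrow> nat \<Rightarrow> clif set" where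
  "G12 p q = {U \<in> cl_real p q. cl_mult p q (cl_rev (cl_hat U)) U = cl_one}"

definition G2 :: "nat \<Rightarrow> nat \<Rightarrow> clif set" where
  "G2 p q = {U \<in> cl_even p q. cl_mult p q (cl_rev U) U = cl_one}"

text \<open>An m x m complex matrix is a function nat => nat => complex vanishing outside
{0..<m} x {0..<m} (indices 0-based); product topology on the function space.\<close>

type_synonym cmat = "nat \<Rightarrow> nat \<Rightarrow> complex"

definition mats :: "nat \<Rightarrow> cmat set" where
  "mats m = {A. \<forall>i j. (m \<le> i \<or> m \<le> j) \<longrightarrow> A i j = 0}"

definition mat_mult :: "nat \<Rightarrow> cmat \<Rightarrow> cmat \<Rightarrow> cmat" where
  "mat_mult m A B = (\<lambda>i j. if i < m \<and> j < m then (\<Sum>k<m. A i k * B k j) else 0)"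

definition mat_one :: "nat \<Rightarrow> cmat" where
  "mat_one m = (\<lambda>i j. if i < m \<and> i = j then 1 else 0)"

definition mat_transpose :: "cmat \<Rightarrow> cmat" where
  "mat_transpose A = (\<lambda>i j. A j i)"

definition mat_adjoint :: "cmat \<Rightarrow> cmat" where
  "mat_adjoint A = (\<lambda>i j. cnj (A j i))"

definition eta_rs :: "nat \<Rightarrow> nat \<Rightarrow> cmat" where
  "eta_rs r s = (\<lambda>i j. if i = j \<and> i < r then 1 else if i = j \<and> r \<le> i \<and> i < r + s then -1 else 0)"

definition Omega :: "nat \<Rightarrow> cmat" where
  "Omega m = (\<lambda>i j. if i < m \<and> j = i + m then -1
                    else if m \<le> i \<and> i < 2*m \<and> j + m = i then 1 else 0)"

definition U_grp :: "nat \<Rightarrow> cmat set" where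
  "U_grp m = {A \<in> mats m. mat_mult m (mat_adjoint A) A = mat_one m}"

definition U_rs :: "nat \<Rightarrow> nat \<Rightarrow> cmat set" where
  "U_rs r s = {A \<in> mats (r+s).
      mat_mult (r+s) (mat_mult (r+s) (mat_adjoint A) (eta_rs r s)) A = eta_rs r s}"

definition Sp_C :: "nat \<Rightarrow> cmat set" where
  "Sp_C m = {A \<in> mats (2*m).
      mat_mult (2*m) (mat_mult (2*m) (mat_transpose A) (Omega m)) A = Omega m}"

definition O_C :: "nat \<Rightarrow> cmat set" where
  "O_C m = {A \<in> mats m. mat_mult m (mat_transpose A) A = mat_one m}"

text \<open>A Lie group isomorphism is rendered as a group isomorphism which is a homeomorphism
(continuous homomorphisms between Lie groups are automatically smooth).\<close>
definition lie_iso ::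
  "'a::topological_space set \<Rightarrow> ('a \<Rightarrow> 'a \<Rightarrow> 'a) \<Rightarrow> 'b::topological_space set \<Rightarrow> ('b \<Rightarrow> 'b \<Rightarrow> 'b) \<Rightarrow> bool" where
  "lie_iso G mG H mH \<longleftrightarrow> (\<exists>f. bij_betw f G H
      \<and> (\<forall>x\<in>G. \<forall>y\<in>G. f (mG x y) = mH (f x) (f y))
      \<and> continuous_on G f \<and> continuous_on H (inv_into G f))"

end

theory Submission
  imports Defs
begin

text \<open>In real coordinates with respect to the blades (for the two groups with \<open>\<i>\<close>, blades in the
generators \<open>\<i> e\<^sup>a\<close>) each group is \<open>{u. \<tau>(u) u = 1}\<close> for the anti-involution with sign \<open>\<tau> = \<plusminus>1\<close> on the
generators. The Jordan-Wigner matrices, rescaled by 1 or \<open>\<i>\<close>, represent the blades by matrices that are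
orthogonal for \<open>Re (tr (A\<^sup>\<dagger> B))\<close>; the hypothesis on \<open>p - q\<close> says exactly that the full blade squares to -1,
hence is orthogonal to 1. Counting blades then shows that the representation is a bijection from the real
algebra onto all complex matrices. The anti-involution becomes \<open>X \<mapsto> S\<^sup>-\<^sup>1 X\<^sup>* S\<close>, where \<open>*\<close> is the adjoint or the
transpose and \<open>S\<close> is a Pauli matrix that commutes or anticommutes with each generator as prescribed. So the
group is the isometry group of the form \<open>S\<close>, and \<open>S\<close> is the identity, or is diagonal with signature 0, or is
symmetric or antisymmetric according to the parity of \<open>(K + 1) div 2\<close>, where \<open>K = n div 2\<close>.\<close>

subsection \<open>Matrices over an index set and isometry groups of forms\<close>

text \<open>The full blade decides between adjoint and transpose. It is central in the represented
  algebra and squares to -1, so it acts as the scalar \<open>\<i>\<close> or \<open>- \<i>\<close>;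
  in particular it is a complex multiple of 1, which is why orthogonality has to be real. The
  anti-involution multiplies it by \<open>\<tau> ^ n * (-1) ^ K\<close>. If this sign is 1, the
  anti-involution is complex linear and becomes a transpose; if it is -1, it is conjugate linear and
  becomes an adjoint. The two kinds of form see different data. The adjoint of a rescaled generator
  depends only on its square, its transpose only on the number of its Jordan-Wigner matrix. Hence
  one form serves the transpose in every signature, and the period 8 in n comes from it: K mod 2
  fixes \<open>\<tau>\<close>, and K mod 4 then fixes the symmetry of S. The unitary form depends on
  which generators square to \<open>- \<tau>\<close>, and to make it diagonal one must be free to
  choose which matrix represents which generator.\<close>

definition fmats :: "'a set \<Rightarrow> ('a \<Rightarrow> 'a \<Rightarrow> complex) set" where
  "fmats I = {X. \<forall>s t. s \<notin> I \<or> t \<notin> I \<longrightarrow> X s t = 0}"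

definition fmul :: "'a set \<Rightarrow> ('a \<Rightarrow> 'a \<Rightarrow> complex) \<Rightarrow> ('a \<Rightarrow> 'a \<Rightarrow> complex) \<Rightarrow> 'a \<Rightarrow> 'a \<Rightarrow> complex" where
  "fmul I X Y = (\<lambda>s t. if s \<in> I \<and> t \<in> I then (\<Sum>r\<in>I. X s r * Y r t) else 0)"

definition fone :: "'a set \<Rightarrow> 'a \<Rightarrow> 'a \<Rightarrow> complex" where
  "fone I = (\<lambda>s t. if s \<in> I \<and> s = t then 1 else 0)"

definition fscale :: "complex \<Rightarrow> ('a \<Rightarrow> 'a \<Rightarrow> complex) \<Rightarrow> 'a \<Rightarrow> 'a \<Rightarrow> complex" where
  "fscale c X = (\<lambda>s t. c * X s t)"

definition fstar :: "(complex \<Rightarrow> complex) \<Rightarrow> ('a \<Rightarrow> 'a \<Rightarrow> complex) \<Rightarrow> 'a \<Rightarrow> 'a \<Rightarrow> complex" where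
  "fstar \<sigma> X = (\<lambda>s t. \<sigma> (X t s))"

definition ftrace :: "'a set \<Rightarrow> ('a \<Rightarrow> 'a \<Rightarrow> complex) \<Rightarrow> complex" where
  "ftrace I X = (\<Sum>s\<in>I. X s s)"

definition frestrict :: "'a set \<Rightarrow> ('a \<Rightarrow> 'a \<Rightarrow> complex) \<Rightarrow> 'a \<Rightarrow> 'a \<Rightarrow> complex" where
  "frestrict I X = (\<lambda>s t. if s \<in> I \<and> t \<in> I then X s t else 0)"

text \<open>The isometries of the form with Gram matrix S, sesquilinear for \<open>cnj\<close> and
  bilinear for the identity. All four classical groups are instances. The index set is arbitrary
  because Pauli matrices are naturally indexed by sets of bits.\<close>

definition form_group :: "'a set \<Rightarrow> (complex \<Rightarrow> complex) \<Rightarrow> ('a \<Rightarrow> 'a \<Rightarrow> complex) \<Rightarrow> ('a \<Rightarrow> 'a \<Rightarrow> complex) set" where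
  "form_group I \<sigma> S = {X \<in> fmats I. fmul I (fmul I (fstar \<sigma> X) S) X = S}"

lemma fmul_assoc:
  assumes "finite I"
  shows "fmul I (fmul I X Y) Z = fmul I X (fmul I Y Z)"
proof (intro ext)
  fix s t
  have "(\<Sum>r\<in>I. (\<Sum>v\<in>I. X s v * Y v r) * Z r t) = (\<Sum>v\<in>I. X s v * (\<Sum>r\<in>I. Y v r * Z r t))"
    unfolding sum_distrib_left sum_distrib_right by (subst sum.swap) (simp add: mult.assoc)
  then show "fmul I (fmul I X Y) Z s t = fmul I X (fmul I Y Z) s t"
    by (simp add: fmul_def cong: sum.cong)
qed

lemma fmul_in [simp]: "fmul I X Y \<in> fmats I"
  by (auto simp: fmats_def fmul_def)

lemma fone_in [simp]: "fone I \<in> fmats I"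
  by (auto simp: fmats_def fone_def)

lemma frestrict_in [simp]: "frestrict I X \<in> fmats I"
  by (auto simp: fmats_def frestrict_def)

lemma fscale_in [simp]: "X \<in> fmats I \<Longrightarrow> fscale c X \<in> fmats I"
  by (auto simp: fmats_def fscale_def)

lemma fmul_one_left: "finite I \<Longrightarrow> X \<in> fmats I \<Longrightarrow> fmul I (fone I) X = X"
  by (intro ext) (auto simp: fmul_def fone_def fmats_def if_distrib [of "\<lambda>x. x * _"] sum.delta cong: if_cong)

lemma fmul_one_right: "finite I \<Longrightarrow> X \<in> fmats I \<Longrightarrow> fmul I X (fone I) = X"
  by (intro ext) (auto simp: fmul_def fone_def fmats_def if_distrib [of "\<lambda>x. _ * x"] sum.delta cong: if_cong)

lemma fmul_scale_left: "fmul I (fscale c X) Y = fscale c (fmul I X Y)"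
  by (intro ext) (auto simp: fmul_def fscale_def sum_distrib_left mult.assoc)

lemma fmul_scale_right: "fmul I X (fscale c Y) = fscale c (fmul I X Y)"
  by (intro ext) (auto simp: fmul_def fscale_def sum_distrib_left algebra_simps)

lemma fscale_fscale: "fscale c (fscale d X) = fscale (c * d) X"
  by (simp add: fscale_def mult.assoc)

lemma fscale_one [simp]: "fscale 1 X = X"
  by (simp add: fscale_def)

lemma ftrace_fmul_commute: "ftrace I (fmul I X Y) = ftrace I (fmul I Y X)"
proof -
  have "(\<Sum>s\<in>I. \<Sum>r\<in>I. X s r * Y r s) = (\<Sum>s\<in>I. \<Sum>r\<in>I. Y s r * X r s)"
    by (subst sum.swap) (simp add: mult.commute)
  then show ?thesis by (simp add: ftrace_def fmul_def cong: sum.cong)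
qed

lemma ftrace_fscale: "ftrace I (fscale c X) = c * ftrace I X"
  by (simp add: ftrace_def fscale_def sum_distrib_left)

text \<open>Both maps fix the reals, so they pass through real combinations of blades; adjoint and
  transpose are treated together.\<close>

definition scalar_conj :: "(complex \<Rightarrow> complex) \<Rightarrow> bool" where
  "scalar_conj \<sigma> \<longleftrightarrow> \<sigma> = (\<lambda>z. z) \<or> \<sigma> = cnj"

lemma scalar_conj_simps:
  assumes "scalar_conj \<sigma>"
  shows "\<sigma> (x + y) = \<sigma> x + \<sigma> y" "\<sigma> (x * y) = \<sigma> x * \<sigma> y" "\<sigma> 0 = 0" "\<sigma> 1 = 1"
    "\<sigma> (of_real a) = of_real a" "\<sigma> (sum f A) = (\<Sum>a\<in>A. \<sigma> (f a))" "\<sigma> (\<sigma> x) = x"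
    "\<sigma> (- x) = - \<sigma> x"
  using assms by (auto simp: scalar_conj_def)

lemma fstar_in: "scalar_conj \<sigma> \<Longrightarrow> X \<in> fmats I \<Longrightarrow> fstar \<sigma> X \<in> fmats I"
  by (auto simp: fmats_def fstar_def scalar_conj_simps)

lemma fstar_fmul: "scalar_conj \<sigma> \<Longrightarrow> fstar \<sigma> (fmul I X Y) = fmul I (fstar \<sigma> Y) (fstar \<sigma> X)"
  by (intro ext) (auto simp: fmul_def fstar_def scalar_conj_simps mult.commute)

lemma fstar_fone: "scalar_conj \<sigma> \<Longrightarrow> fstar \<sigma> (fone I) = fone I"
  by (intro ext) (auto simp: fone_def fstar_def scalar_conj_simps)

lemma fstar_fscale: "scalar_conj \<sigma> \<Longrightarrow> fstar \<sigma> (fscale c X) = fscale (\<sigma> c) (fstar \<sigma> X)"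
  by (intro ext) (auto simp: fscale_def fstar_def scalar_conj_simps)

text \<open>With an explicit inverse g, continuity of the inverse is read off a formula instead of
  \<open>inv_into\<close>.\<close>

lemma lie_isoI:
  assumes "\<And>x. x \<in> G \<Longrightarrow> f x \<in> H" "\<And>y. y \<in> H \<Longrightarrow> g y \<in> G"
    and gf: "\<And>x. x \<in> G \<Longrightarrow> g (f x) = x" and fg: "\<And>y. y \<in> H \<Longrightarrow> f (g y) = y"
    and "\<And>x y. x \<in> G \<Longrightarrow> y \<in> G \<Longrightarrow> f (mG x y) = mH (f x) (f y)"
    and "continuous_on G f" "continuous_on H g"
  shows "lie_iso G mG H mH"
proof -
  have bij: "bij_betw f G H"
    by (rule bij_betw_byWitness [where f' = g]) (use assms in auto)
  have "inv_into G f y = g y" if "y \<in> H" for y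
    using bij assms that by (metis bij_betw_inv_into_left)
  then have "continuous_on H (inv_into G f)"
    using assms(7) by (simp cong: continuous_on_cong)
  with bij assms show ?thesis unfolding lie_iso_def by blast
qed

lemma lie_iso_trans:
  assumes "lie_iso G mG H mH" "lie_iso H mH L mL"
  shows "lie_iso G mG L mL"
proof -
  obtain f where f: "bij_betw f G H" "\<forall>x\<in>G. \<forall>y\<in>G. f (mG x y) = mH (f x) (f y)"
      "continuous_on G f" "continuous_on H (inv_into G f)"
    using assms(1) unfolding lie_iso_def by blast
  obtain g where g: "bij_betw g H L" "\<forall>x\<in>H. \<forall>y\<in>H. g (mH x y) = mL (g x) (g y)"
      "continuous_on H g" "continuous_on L (inv_into H g)"
    using assms(2) unfolding lie_iso_def by blast
  show ?thesis
  proof (rule lie_isoI [where f = "g \<circ> f" and g = "inv_into G f \<circ> inv_into H g"])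
    show "continuous_on G (g \<circ> f)"
      using f(1,3) g(3) by (intro continuous_on_compose) (auto simp: bij_betw_def)
    have "inv_into H g ` L = H" using g(1) by (metis bij_betw_def bij_betw_inv_into)
    then show "continuous_on L (inv_into G f \<circ> inv_into H g)"
      using f(4) g(4) by (intro continuous_on_compose) auto
    have F: "f x \<in> H" if "x \<in> G" for x using f(1) that by (rule bij_betw_apply)
    have F': "inv_into G f x \<in> G" if "x \<in> H" for x
      using bij_betw_inv_into [OF f(1)] that by (rule bij_betw_apply)
    have K: "g x \<in> L" if "x \<in> H" for x using g(1) that by (rule bij_betw_apply)
    have K': "inv_into H g x \<in> H" if "x \<in> L" for x
      using bij_betw_inv_into [OF g(1)] that by (rule bij_betw_apply)
    show "(g \<circ> f) x \<in> L" if "x \<in> G" for x using F K that by simp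
    show "(inv_into G f \<circ> inv_into H g) x \<in> G" if "x \<in> L" for x using F' K' that by simp
    show "(inv_into G f \<circ> inv_into H g) ((g \<circ> f) x) = x" if "x \<in> G" for x
      using F [OF that] that by (simp add: bij_betw_inv_into_left [OF f(1)] bij_betw_inv_into_left [OF g(1)])
    show "(g \<circ> f) ((inv_into G f \<circ> inv_into H g) x) = x" if "x \<in> L" for x
      using K' [OF that] that by (simp add: bij_betw_inv_into_right [OF f(1)] bij_betw_inv_into_right [OF g(1)])
    show "(g \<circ> f) (mG x y) = mL ((g \<circ> f) x) ((g \<circ> f) y)" if "x \<in> G" "y \<in> G" for x y
      using f(2) g(2) F that by simp
  qed
qed

section \<open>Relabelling and change of basis for forms\<close>

lemma continuous_on_matrixI:
  fixes f :: "'c::topological_space \<Rightarrow> 'a \<Rightarrow> 'b \<Rightarrow> 'd::topological_space"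
  assumes "\<And>s t. continuous_on G (\<lambda>X. f X s t)"
  shows "continuous_on G f"
  by (intro continuous_on_coordinatewise_then_product assms)

lemma continuous_on_entry: "continuous_on G (\<lambda>X :: 'a \<Rightarrow> 'b \<Rightarrow> 'd::topological_space. X s t)"
  using continuous_on_product_then_coordinatewise [OF continuous_on_product_then_coordinatewise [OF continuous_on_id]] .

lemma continuous_on_coord: "continuous_on G (\<lambda>X :: 'a \<Rightarrow> 'd::topological_space. X s)"
  using continuous_on_product_then_coordinatewise [OF continuous_on_id] .

text \<open>Renaming basis vectors along h pulls the form S back to R. A suitable order of the basis
  later turns a Pauli form into a standard Gram matrix.\<close>

lemma form_group_reindex:
  assumes h: "bij_betw h L I"
    and RS: "\<And>i j. i \<in> L \<Longrightarrow> j \<in> L \<Longrightarrow> R i j = S (h i) (h j)"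
    and S: "S \<in> fmats I" and R: "R \<in> fmats L" and \<sigma>: "scalar_conj \<sigma>"
  shows "lie_iso (form_group I \<sigma> S) (fmul I) (form_group L \<sigma> R) (fmul L)"
proof -
  define k where "k = inv_into L h"
  have k: "bij_betw k I L" using h by (simp add: k_def bij_betw_inv_into)
  have hk: "h (k s) = s" if "s \<in> I" for s using h that by (simp add: k_def bij_betw_inv_into_right)
  have kh: "k (h s) = s" if "s \<in> L" for s using h that by (simp add: k_def bij_betw_inv_into_left)
  have hI: "h i \<in> I" if "i \<in> L" for i using h that by (simp add: bij_betw_apply)
  have kI: "k i \<in> L" if "i \<in> I" for i using k that by (simp add: bij_betw_apply)
  define f where "f X = (\<lambda>i j. if i \<in> L \<and> j \<in> L then X (h i) (h j) else 0 :: complex)" for X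
  define g where "g X = (\<lambda>i j. if i \<in> I \<and> j \<in> I then X (k i) (k j) else 0 :: complex)" for X
  have fm: "f (fmul I X Y) = fmul L (f X) (f Y)" for X Y
  proof (intro ext)
    fix i j
    have "(\<Sum>r\<in>I. X (h i) r * Y r (h j)) = (\<Sum>r\<in>L. X (h i) (h r) * Y (h r) (h j))"
      using sum.reindex_bij_betw [OF h, of "\<lambda>r. X (h i) r * Y r (h j)"] by simp
    then show "f (fmul I X Y) i j = fmul L (f X) (f Y) i j"
      by (auto simp: f_def fmul_def hI cong: sum.cong)
  qed
  have gm: "g (fmul L X Y) = fmul I (g X) (g Y)" for X Y
  proof (intro ext)
    fix i j
    have "(\<Sum>r\<in>L. X (k i) r * Y r (k j)) = (\<Sum>r\<in>I. X (k i) (k r) * Y (k r) (k j))"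
      using sum.reindex_bij_betw [OF k, of "\<lambda>r. X (k i) r * Y r (k j)"] by simp
    then show "g (fmul L X Y) i j = fmul I (g X) (g Y) i j"
      by (auto simp: g_def fmul_def kI cong: sum.cong)
  qed
  have fs: "f (fstar \<sigma> X) = fstar \<sigma> (f X)" for X
    by (auto simp: f_def fstar_def scalar_conj_simps(3) [OF \<sigma>] fun_eq_iff)
  have gs: "g (fstar \<sigma> X) = fstar \<sigma> (g X)" for X
    by (auto simp: g_def fstar_def scalar_conj_simps(3) [OF \<sigma>] fun_eq_iff)
  have fS: "f S = R" using RS R by (auto simp: f_def fmats_def fun_eq_iff)
  have gR: "g R = S" using RS S by (auto simp: g_def fmats_def fun_eq_iff hk kI)
  show ?thesis
  proof (rule lie_isoI [where f = f and g = g])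
    show "f X \<in> form_group L \<sigma> R" if "X \<in> form_group I \<sigma> S" for X
    proof -
      have "f (fmul I (fmul I (fstar \<sigma> X) S) X) = f S" using that by (simp add: form_group_def)
      then show ?thesis by (auto simp: form_group_def fm fs fS fmats_def) (auto simp: f_def)
    qed
    show "g X \<in> form_group I \<sigma> S" if "X \<in> form_group L \<sigma> R" for X
    proof -
      have "g (fmul L (fmul L (fstar \<sigma> X) R) X) = g R" using that by (simp add: form_group_def)
      then show ?thesis by (auto simp: form_group_def gm gs gR fmats_def) (auto simp: g_def)
    qed
    show "g (f X) = X" if "X \<in> form_group I \<sigma> S" for X
      using that by (auto simp: form_group_def fmats_def f_def g_def fun_eq_iff hk kI)
    show "f (g X) = X" if "X \<in> form_group L \<sigma> R" for X
      using that by (auto simp: form_group_def fmats_def f_def g_def fun_eq_iff kh hI)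
    have "continuous_on G (\<lambda>X. if b then X s t else 0)" for b G and s t :: 'b
      by (cases b) (simp_all add: continuous_on_entry)
    then show "continuous_on (form_group I \<sigma> S) f"
      unfolding f_def by (intro continuous_on_matrixI)
    have "continuous_on G (\<lambda>X. if b then X s t else 0)" for b G and s t :: 'a
      by (cases b) (simp_all add: continuous_on_entry)
    then show "continuous_on (form_group L \<sigma> R) g"
      unfolding g_def by (intro continuous_on_matrixI)
  qed (rule fm)
qed

lemma continuous_on_fmul_conjugate:
  "finite I \<Longrightarrow> continuous_on G (\<lambda>X. fmul I (fmul I T X) T')"
proof (rule continuous_on_matrixI)
  fix s t
  assume "finite I"
  have "continuous_on G (\<lambda>X. \<Sum>r\<in>I. (\<Sum>v\<in>I. T s v * X v r) * T' r t)"
    by (intro continuous_intros continuous_on_entry)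
  then show "continuous_on G (\<lambda>X. fmul I (fmul I T X) T' s t)"
    by (cases "s \<in> I \<and> t \<in> I") (auto simp: fmul_def cong: sum.cong)
qed

text \<open>T is a change of basis under which the form R pulls back to S, so conjugation by T
  carries isometries of S to isometries of R.\<close>

lemma form_group_conjugate:
  assumes I: "finite I" and \<sigma>: "scalar_conj \<sigma>"
    and T: "T \<in> fmats I" "T' \<in> fmats I" "fmul I T T' = fone I" "fmul I T' T = fone I"
    and S: "S = fmul I (fmul I (fstar \<sigma> T) R) T" and R: "R \<in> fmats I"
  shows "lie_iso (form_group I \<sigma> S) (fmul I) (form_group I \<sigma> R) (fmul I)"
proof -
  note assoc = fmul_assoc [OF I]
  define f where "f X = fmul I (fmul I T X) T'" for X
  define g where "g X = fmul I (fmul I T' X) T" for X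
  have T2: "fmul I T (fmul I T' X) = X" "fmul I T' (fmul I T X) = X" if "X \<in> fmats I" for X
    using T that by (simp_all add: assoc [symmetric] fmul_one_left I)
  have s1: "fmul I (fstar \<sigma> T) (fstar \<sigma> T') = fone I" "fmul I (fstar \<sigma> T') (fstar \<sigma> T) = fone I"
    using T by (simp_all add: fstar_fmul [OF \<sigma>, symmetric] fstar_fone [OF \<sigma>])
  have s2: "fmul I (fstar \<sigma> T) (fmul I (fstar \<sigma> T') X) = X"
     "fmul I (fstar \<sigma> T') (fmul I (fstar \<sigma> T) X) = X" if "X \<in> fmats I" for X
    using s1 that by (simp_all add: assoc [symmetric] fmul_one_left I)
  have R': "R = fmul I (fmul I (fstar \<sigma> T') S) T'"
    unfolding S by (simp add: assoc T s2 fmul_one_right I R)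
  show ?thesis
  proof (rule lie_isoI [where f = f and g = g])
    show "f X \<in> form_group I \<sigma> R" if "X \<in> form_group I \<sigma> S" for X
    proof -
      have X: "X \<in> fmats I" "fmul I (fstar \<sigma> X) (fmul I S X) = S"
        using that by (auto simp: form_group_def assoc)
      have "fmul I (fmul I (fstar \<sigma> (f X)) R) (f X)
         = fmul I (fstar \<sigma> T') (fmul I (fmul I (fstar \<sigma> X) (fmul I S X)) T')"
        unfolding f_def R' by (simp add: fstar_fmul [OF \<sigma>] assoc s2 T2)
      also have "\<dots> = R" using X R' by (simp add: assoc)
      finally show ?thesis by (simp add: form_group_def f_def)
    qed
    show "g X \<in> form_group I \<sigma> S" if "X \<in> form_group I \<sigma> R" for X
    proof -
      have X: "X \<in> fmats I" "fmul I (fstar \<sigma> X) (fmul I R X) = R"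
        using that by (auto simp: form_group_def assoc)
      have "fmul I (fmul I (fstar \<sigma> (g X)) S) (g X)
         = fmul I (fstar \<sigma> T) (fmul I (fmul I (fstar \<sigma> X) (fmul I R X)) T)"
        unfolding g_def S by (simp add: fstar_fmul [OF \<sigma>] assoc s2 T2)
      also have "\<dots> = S" using X S by (simp add: assoc)
      finally show ?thesis by (simp add: form_group_def g_def)
    qed
    show "g (f X) = X" if "X \<in> form_group I \<sigma> S" for X
      using that by (auto simp: form_group_def f_def g_def assoc T T2 fmul_one_right I)
    show "f (g X) = X" if "X \<in> form_group I \<sigma> R" for X
      using that by (auto simp: form_group_def f_def g_def assoc T T2 fmul_one_right I)
    show "f (fmul I X Y) = fmul I (f X) (f Y)" if "Y \<in> form_group I \<sigma> S" for X Y
      using that by (simp add: f_def assoc T2)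
    show "continuous_on (form_group I \<sigma> S) f" "continuous_on (form_group I \<sigma> R) g"
      unfolding f_def g_def by (intro continuous_on_fmul_conjugate I)+
  qed
qed

subsection \<open>Blades of anticommuting families\<close>

text \<open>The real counterpart of \<open>blade_sign\<close>, with arbitrary squares
  \<open>\<zeta>\<close> so that the generators \<open>\<i> e\<^sup>a\<close> are covered as
  well.\<close>

definition cl_sign :: "(nat \<Rightarrow> real) \<Rightarrow> nat set \<Rightarrow> nat set \<Rightarrow> real" where
  "cl_sign \<zeta> A B = (-1) ^ card {(a, b). a \<in> A \<and> b \<in> B \<and> b < a} * (\<Prod>a\<in>A \<inter> B. \<zeta> a)"

text \<open>The sign of the permutation reversing a word of m letters.\<close>

definition rev_sign :: "nat \<Rightarrow> real" where
  "rev_sign m = (-1) ^ (m * (m - 1) div 2)"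

lemma rev_sign_Suc: "rev_sign (Suc m) = (-1) ^ m * rev_sign m"
proof -
  have "Suc m * m = m * (m - 1) + m * 2" by (cases m) (auto simp: algebra_simps)
  then have "Suc m * m div 2 = m * (m - 1) div 2 + m" by simp
  then show ?thesis by (simp add: rev_sign_def power_add)
qed

lemma rev_sign_0 [simp]: "rev_sign 0 = 1"
  by (simp add: rev_sign_def)

lemma rev_sign_square: "rev_sign m * rev_sign m = 1"
  by (simp add: rev_sign_def flip: power_mult_distrib)

lemma symdiff_commute: "symdiff A B = symdiff B A"
  and symdiff_assoc: "symdiff (symdiff A B) C = symdiff A (symdiff B C)"
  and symdiff_self [simp]: "symdiff A A = {}"
  and symdiff_empty [simp]: "symdiff A {} = A" "symdiff {} A = A"
  and symdiff_cancel [simp]: "symdiff A (symdiff A B) = B"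
  by (auto simp: symdiff_def)

lemma symdiff_eq_empty_iff [simp]: "symdiff A B = {} \<longleftrightarrow> A = B"
  by (auto simp: symdiff_def)

lemma symdiff_subset: "A \<subseteq> C \<Longrightarrow> B \<subseteq> C \<Longrightarrow> symdiff A B \<subseteq> C"
  by (auto simp: symdiff_def)

lemma card_symdiff:
  assumes "finite A" "finite B"
  shows "card (symdiff A B) + 2 * card (A \<inter> B) = card A + card B"
proof -
  have "card A = card (A - B) + card (A \<inter> B)" "card B = card (B - A) + card (A \<inter> B)"
    using assms by (metis add.commute card_Int_Diff Int_commute)+
  moreover have "card (symdiff A B) = card (A - B) + card (B - A)"
    unfolding symdiff_def using assms by (intro card_Un_disjoint) auto
  ultimately show ?thesis by simp
qed

lemma even_card_symdiff:
  "finite A \<Longrightarrow> finite B \<Longrightarrow> even (card (symdiff A B)) \<longleftrightarrow> even (card A + card B)"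
  by (metis card_symdiff dvd_triv_left even_add)

lemma minus_one_power_card_symdiff_Int:
  assumes "finite A" "finite B"
  shows "(-1::'a::comm_ring_1) ^ card (symdiff A B \<inter> Z) = (-1) ^ card (A \<inter> Z) * (-1) ^ card (B \<inter> Z)"
proof -
  have "symdiff A B \<inter> Z = symdiff (A \<inter> Z) (B \<inter> Z)" by (auto simp: symdiff_def)
  then have "even (card (symdiff A B \<inter> Z)) \<longleftrightarrow> even (card (A \<inter> Z) + card (B \<inter> Z))"
    using assms by (simp add: even_card_symdiff)
  then show ?thesis unfolding power_add [symmetric] by (metis minus_one_power_iff)
qed

lemma finite_inversions: "finite A \<Longrightarrow> finite B \<Longrightarrow> finite {(a, b). a \<in> A \<and> b \<in> B \<and> P a b}"
  by (rule finite_subset [of _ "A \<times> B"]) auto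

text \<open>Together with the two cases below, this is a recursion on the largest index k. At the
  end of the right factor k causes no inversion; at the end of the left factor it has to pass all of
  B, and there it may meet its own copy and be squared.\<close>

lemma cl_sign_insert_right:
  assumes "A \<subseteq> {..<k}"
  shows "cl_sign \<zeta> A (insert k B) = cl_sign \<zeta> A B"
proof -
  have "{(a, b). a \<in> A \<and> b \<in> insert k B \<and> b < a} = {(a, b). a \<in> A \<and> b \<in> B \<and> b < a}"
    using assms by fastforce
  moreover have "A \<inter> insert k B = A \<inter> B" using assms by auto
  ultimately show ?thesis by (simp only: cl_sign_def)
qed

lemma card_inversions_insert_left:
  fixes k :: nat
  assumes "A \<subseteq> {..<k}" "B \<subseteq> {..<k}"
  shows "card {(a, b). a \<in> insert k A \<and> b \<in> B \<and> b < a} = card B + card {(a, b). a \<in> A \<and> b \<in> B \<and> b < a}"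
proof -
  have "finite A" "finite B" "k \<notin> A" using assms by (auto intro: finite_subset)
  have "{(a, b). a \<in> insert k A \<and> b \<in> B \<and> b < a} = Pair k ` B \<union> {(a, b). a \<in> A \<and> b \<in> B \<and> b < a}"
    using assms by auto
  moreover have "card (Pair k ` B \<union> {(a, b). a \<in> A \<and> b \<in> B \<and> b < a})
     = card (Pair k ` B) + card {(a, b). a \<in> A \<and> b \<in> B \<and> b < a}"
    using \<open>finite A\<close> \<open>finite B\<close> \<open>k \<notin> A\<close> by (intro card_Un_disjoint finite_inversions) auto
  moreover have "card (Pair k ` B) = card B" by (intro card_image) (auto simp: inj_on_def)
  ultimately show ?thesis by (simp only:)
qed

lemma cl_sign_insert_left:
  assumes "A \<subseteq> {..<k}" "B \<subseteq> {..<k}"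
  shows "cl_sign \<zeta> (insert k A) B = (-1) ^ card B * cl_sign \<zeta> A B"
proof -
  have "insert k A \<inter> B = A \<inter> B" using assms by auto
  then show ?thesis
    using card_inversions_insert_left [OF assms] by (simp only: cl_sign_def power_add mult.assoc)
qed

lemma cl_sign_insert_both:
  assumes "A \<subseteq> {..<k}" "B \<subseteq> {..<k}"
  shows "cl_sign \<zeta> (insert k A) (insert k B) = (-1) ^ card B * \<zeta> k * cl_sign \<zeta> A B"
proof -
  have "{(a, b). a \<in> insert k A \<and> b \<in> insert k B \<and> b < a} = {(a, b). a \<in> insert k A \<and> b \<in> B \<and> b < a}"
    using assms by auto
  moreover have "insert k A \<inter> insert k B = insert k (A \<inter> B)" by auto
  moreover have "(\<Prod>a\<in>insert k (A \<inter> B). \<zeta> a) = \<zeta> k * (\<Prod>a\<in>A \<inter> B. \<zeta> a)"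
    using assms by (intro prod.insert) (auto intro: finite_subset)
  ultimately show ?thesis
    using card_inversions_insert_left [OF assms] by (simp only: cl_sign_def power_add ac_simps)
qed

text \<open>This sign is the square of the blade: after the second copy is reversed, equal
  generators meet from the middle outwards.\<close>

lemma cl_sign_self:
  assumes "finite A"
  shows "cl_sign \<zeta> A A = rev_sign (card A) * prod \<zeta> A"
  using assms
proof (induction A rule: finite_linorder_max_induct)
  case empty
  then show ?case by (simp add: cl_sign_def)
next
  case (insert k A)
  then have "A \<subseteq> {..<k}" "k \<notin> A" by auto
  with insert show ?case
    by (simp add: cl_sign_insert_both rev_sign_Suc)
qed

lemma subset_lessThan_Suc_cases:
  fixes k :: nat
  assumes "A \<subseteq> {..<Suc k}"
  obtains "A \<subseteq> {..<k}" | A' where "A = insert k A'" "A' \<subseteq> {..<k}"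
proof (cases "k \<in> A")
  case True
  then have "A = insert k (A - {k})" "A - {k} \<subseteq> {..<k}" using assms by auto
  then show ?thesis using that(2) by blast
next
  case False
  then have "A \<subseteq> {..<k}" using assms less_Suc_eq by auto
  then show ?thesis using that(1) by blast
qed

lemma symdiff_insert:
  assumes "A \<subseteq> {..<k}" "B \<subseteq> {..<k::nat}"
  shows "symdiff A (insert k B) = insert k (symdiff A B)"
    "symdiff (insert k A) B = insert k (symdiff A B)"
    "symdiff (insert k A) (insert k B) = symdiff A B"
proof -
  have "k \<notin> A" "k \<notin> B" using assms by auto
  then show "symdiff A (insert k B) = insert k (symdiff A B)"
    "symdiff (insert k A) B = insert k (symdiff A B)"
    "symdiff (insert k A) (insert k B) = symdiff A B"
    by (auto simp: symdiff_def)
qed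

text \<open>The factors do not commute, so the product is built along the increasing bound k, which
  is also the induction variable below.\<close>

primrec blade :: "'a set \<Rightarrow> (nat \<Rightarrow> 'a \<Rightarrow> 'a \<Rightarrow> complex) \<Rightarrow> nat \<Rightarrow> nat set \<Rightarrow> 'a \<Rightarrow> 'a \<Rightarrow> complex" where
  "blade J g 0 A = fone J"
| "blade J g (Suc k) A = (if k \<in> A then fmul J (blade J g k A) (g k) else blade J g k A)"

lemma blade_insert_ge: "k \<le> a \<Longrightarrow> blade J g k (insert a A) = blade J g k A"
  by (induction k) auto

lemma blade_Suc_insert: "blade J g (Suc k) (insert k A) = fmul J (blade J g k A) (g k)"
  by (simp add: blade_insert_ge)

lemma blade_Suc_subset: "A \<subseteq> {..<k} \<Longrightarrow> blade J g (Suc k) A = blade J g k A"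
  by auto

lemma blade_empty [simp]: "blade J g k {} = fone J"
  by (induction k) auto

lemma blade_in [simp]: "blade J g k A \<in> fmats J"
  by (induction k) auto

text \<open>Passing each factor costs its own scalar. This is used for a generator against a lower
  blade and for the matrix of the form against all blades.\<close>

lemma blade_swap:
  assumes J: "finite J" and X: "X \<in> fmats J"
    and c: "\<And>a. a < k \<Longrightarrow> fmul J X (g a) = fscale (c a) (fmul J (g a) X)"
  shows "A \<subseteq> {..<k} \<Longrightarrow> fmul J X (blade J g k A) = fscale (\<Prod>a\<in>A. c a) (fmul J (blade J g k A) X)"
  using c
proof (induction k arbitrary: A)
  case 0
  then show ?case by (simp add: fmul_one_left fmul_one_right J X)
next
  case (Suc k)
  from Suc.prems(1) show ?case
  proof (cases rule: subset_lessThan_Suc_cases)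
    case 1
    then show ?thesis using Suc by (simp add: blade_Suc_subset del: blade.simps)
  next
    case (2 A')
    then have fin: "finite A'" "k \<notin> A'" by (auto intro: finite_subset)
    have "fmul J X (fmul J (blade J g k A') (g k))
        = fscale (prod c A') (fmul J (blade J g k A') (fmul J X (g k)))"
      using Suc.IH [OF 2(2)] Suc.prems(2)
      by (metis fmul_assoc [OF J] fmul_scale_left less_Suc_eq)
    also have "\<dots> = fscale (c k * prod c A') (fmul J (fmul J (blade J g k A') (g k)) X)"
      using Suc.prems(2) [of k]
      by (simp add: fmul_scale_right fscale_fscale fmul_assoc [OF J] mult.commute)
    finally show ?thesis using 2 fin by (simp add: blade_Suc_insert del: blade.simps)
  qed
qed

locale clifford_family =
  fixes J :: "'a set" and g :: "nat \<Rightarrow> 'a \<Rightarrow> 'a \<Rightarrow> complex" and n :: nat and \<zeta> :: "nat \<Rightarrow> real"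
  assumes J: "finite J"
    and g_in: "a < n \<Longrightarrow> g a \<in> fmats J"
    and g_square: "a < n \<Longrightarrow> fmul J (g a) (g a) = fscale (of_real (\<zeta> a)) (fone J)"
    and g_anticomm: "a < n \<Longrightarrow> b < n \<Longrightarrow> a \<noteq> b \<Longrightarrow> fmul J (g a) (g b) = fscale (-1) (fmul J (g b) (g a))"
begin

lemma g_blade_swap:
  assumes "k < n" "A \<subseteq> {..<k}"
  shows "fmul J (g k) (blade J g k A) = fscale ((-1) ^ card A) (fmul J (blade J g k A) (g k))"
proof -
  have "fmul J (g k) (blade J g k A) = fscale (\<Prod>a\<in>A. -1) (fmul J (blade J g k A) (g k))"
    using assms by (intro blade_swap J g_in g_anticomm) auto
  then show ?thesis by simp
qed

text \<open>Anticommutation and the squares alone determine the multiplication table, so the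
  matrices multiply with the same signs as the basis of the algebra.\<close>

lemma blade_fmul_blade:
  "k \<le> n \<Longrightarrow> A \<subseteq> {..<k} \<Longrightarrow> B \<subseteq> {..<k} \<Longrightarrow>
    fmul J (blade J g k A) (blade J g k B) = fscale (of_real (cl_sign \<zeta> A B)) (blade J g k (symdiff A B))"
proof (induction k arbitrary: A B)
  case 0
  then show ?case by (simp add: fmul_one_left J cl_sign_def)
next
  case (Suc k)
  let ?b = "blade J g k"
  from Suc.prems have k: "k < n" "k \<le> n" by auto
  note IH = Suc.IH [OF k(2)]
  note assoc = fmul_assoc [OF J]
  note simps = fmul_scale_left fmul_scale_right fscale_fscale
  \<comment> \<open>If k occurs in the left blade, its matrix is pulled out to the right through the
    blade B; both cases for the right blade start from this.\<close>
  have move: "fmul J (fmul J (?b A) (g k)) (?b B) = fscale ((-1) ^ card B * of_real (cl_sign \<zeta> A B)) (fmul J (?b (symdiff A B)) (g k))"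
    if "A \<subseteq> {..<k}" "B \<subseteq> {..<k}" for A B
  proof -
    have "fmul J (fmul J (?b A) (g k)) (?b B) = fscale ((-1) ^ card B) (fmul J (fmul J (?b A) (?b B)) (g k))"
      using that k by (simp add: assoc g_blade_swap simps)
    then show ?thesis using that by (simp add: IH simps)
  qed
  from Suc.prems(2) show ?case
  proof (cases rule: subset_lessThan_Suc_cases)
    case A: 1
    from Suc.prems(3) show ?thesis
    proof (cases rule: subset_lessThan_Suc_cases)
      case 1
      with A show ?thesis by (simp add: blade_Suc_subset symdiff_subset IH del: blade.simps)
    next
      case (2 B')
      with A show ?thesis
        by (simp add: blade_Suc_subset blade_Suc_insert symdiff_subset symdiff_insert cl_sign_insert_right
              assoc [symmetric] IH simps del: blade.simps)
    qed
  next
    case A: (2 A')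
    from Suc.prems(3) show ?thesis
    proof (cases rule: subset_lessThan_Suc_cases)
      case 1
      with A show ?thesis
        by (simp add: blade_Suc_subset [of B] blade_Suc_insert symdiff_insert cl_sign_insert_left move
              del: blade.simps)
    next
      case (2 B')
      have "fmul J (fmul J (?b A') (g k)) (fmul J (?b B') (g k)) =
         fscale ((-1) ^ card B' * of_real (cl_sign \<zeta> A' B')) (fmul J (?b (symdiff A' B')) (fmul J (g k) (g k)))"
        using A 2 by (simp add: assoc [symmetric] move simps)
      also have "\<dots> = fscale ((-1) ^ card B' * of_real (cl_sign \<zeta> A' B') * of_real (\<zeta> k)) (?b (symdiff A' B'))"
        using k by (simp add: g_square simps fmul_one_right J)
      finally show ?thesis using A 2
        by (simp add: blade_Suc_subset symdiff_subset blade_Suc_insert symdiff_insert cl_sign_insert_both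
              ac_simps del: blade.simps)
    qed
  qed
qed

text \<open>The star reverses the order of the factors. Restoring it costs the reversal sign, and
  each factor adds its own \<open>\<epsilon>\<close>.\<close>

lemma fstar_blade:
  assumes \<sigma>: "scalar_conj \<sigma>" and \<epsilon>: "\<And>a. a < n \<Longrightarrow> fstar \<sigma> (g a) = fscale (of_real (\<epsilon> a)) (g a)"
  shows "k \<le> n \<Longrightarrow> A \<subseteq> {..<k} \<Longrightarrow>
    fstar \<sigma> (blade J g k A) = fscale (of_real (rev_sign (card A) * prod \<epsilon> A)) (blade J g k A)"
proof (induction k arbitrary: A)
  case 0
  then show ?case by (simp add: fstar_fone [OF \<sigma>])
next
  case (Suc k)
  from Suc.prems(2) show ?case
  proof (cases rule: subset_lessThan_Suc_cases)
    case 1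
    then show ?thesis using Suc by (simp add: blade_Suc_subset del: blade.simps)
  next
    case (2 A')
    then have fin: "finite A'" "k \<notin> A'" by (auto intro: finite_subset)
    have "fstar \<sigma> (fmul J (blade J g k A') (g k)) =
        fscale (of_real (\<epsilon> k * (rev_sign (card A') * prod \<epsilon> A') * (-1) ^ card A')) (fmul J (blade J g k A') (g k))"
      using Suc 2 by (simp add: fstar_fmul [OF \<sigma>] \<epsilon> g_blade_swap fmul_scale_left fmul_scale_right fscale_fscale ac_simps)
    then show ?thesis using 2 fin
      by (simp add: blade_Suc_insert rev_sign_Suc ac_simps del: blade.simps)
  qed
qed

end

subsection \<open>Representations by orthogonal blades\<close>

text \<open>The squared distances of the basis vectors from the span of the rows add up to 0.\<close>
lemma orthogonal_rows_imp_columns: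
  fixes Q :: "'b \<Rightarrow> 'c \<Rightarrow> real"
  assumes fin: "finite P" "finite L" and card: "card P = card L"
    and rows: "\<And>i j. i \<in> P \<Longrightarrow> j \<in> P \<Longrightarrow> (\<Sum>l\<in>L. Q i l * Q j l) = (if i = j then c else 0)"
    and lm: "l \<in> L" "m \<in> L"
  shows "(\<Sum>j\<in>P. Q j l * Q j m) = (if l = m then c else 0)"
proof -
  \<comment> \<open>Row l is c times the basis vector l minus c times its projection to the span;
    scaling by c avoids a division.\<close>
  define E where "E l m = (if l = m then c else 0) - (\<Sum>j\<in>P. Q j l * Q j m)" for l m
  have col: "(\<Sum>m\<in>L. (E l m)\<^sup>2) = c\<^sup>2 - c * (\<Sum>j\<in>P. (Q j l)\<^sup>2)" if "l \<in> L" for l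
  proof -
    have sq: "(E l m)\<^sup>2 = (if l = m then c\<^sup>2 else 0) - 2 * (if l = m then c * (\<Sum>j\<in>P. Q j l * Q j m) else 0)
        + (\<Sum>j\<in>P. \<Sum>i\<in>P. Q j l * Q i l * (Q j m * Q i m))" for m
      unfolding E_def power2_eq_square by (auto simp: algebra_simps sum_product sum_distrib_left)
    have "(\<Sum>m\<in>L. \<Sum>j\<in>P. \<Sum>i\<in>P. Q j l * Q i l * (Q j m * Q i m))
       = (\<Sum>j\<in>P. \<Sum>i\<in>P. Q j l * Q i l * (\<Sum>m\<in>L. Q j m * Q i m))"
      by (subst sum.swap, rule sum.cong [OF refl], subst sum.swap) (simp add: sum_distrib_left)
    also have "\<dots> = (\<Sum>j\<in>P. \<Sum>i\<in>P. if j = i then Q j l * Q i l * c else 0)"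
      by (intro sum.cong refl) (simp add: rows)
    also have "\<dots> = c * (\<Sum>j\<in>P. (Q j l)\<^sup>2)"
      using fin by (simp add: sum_distrib_left power2_eq_square ac_simps)
    finally show ?thesis
      using that fin
      unfolding sq by (simp add: sum.distrib sum_subtractf sum_distrib_left [symmetric] power2_eq_square)
  qed
  have "(\<Sum>l\<in>L. \<Sum>m\<in>L. (E l m)\<^sup>2) = c\<^sup>2 * card L - c * (\<Sum>l\<in>L. \<Sum>j\<in>P. (Q j l)\<^sup>2)"
    by (simp add: col sum_subtractf sum_distrib_left)
  also have "(\<Sum>l\<in>L. \<Sum>j\<in>P. (Q j l)\<^sup>2) = (\<Sum>j\<in>P. \<Sum>l\<in>L. Q j l * Q j l)"
    by (subst sum.swap) (simp add: power2_eq_square)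
  \<comment> \<open>Equal cardinalities enter here: the row norms sum to \<open>c * card P\<close>,
    which cancels \<open>c\<^sup>2 * card L\<close>.\<close>
  also have "\<dots> = c * card L" by (simp add: rows card)
  finally have "(\<Sum>l\<in>L. \<Sum>m\<in>L. (E l m)\<^sup>2) = 0" by (simp add: power2_eq_square)
  then have "E l m = 0"
    using lm fin by (simp add: sum_nonneg_eq_0_iff sum_nonneg)
  then show ?thesis by (simp add: E_def)
qed

definition real_cl_mult :: "nat \<Rightarrow> (nat \<Rightarrow> real) \<Rightarrow> (nat set \<Rightarrow> real) \<Rightarrow> (nat set \<Rightarrow> real) \<Rightarrow> nat set \<Rightarrow> real" where
  "real_cl_mult n \<zeta> u v = (\<lambda>C. if C \<subseteq> {..<n}
      then (\<Sum>A\<in>Pow {..<n}. u A * v (symdiff A C) * cl_sign \<zeta> A (symdiff A C)) else 0)"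

definition real_cl_inv :: "real \<Rightarrow> (nat set \<Rightarrow> real) \<Rightarrow> nat set \<Rightarrow> real" where
  "real_cl_inv \<tau> u = (\<lambda>A. rev_sign (card A) * \<tau> ^ card A * u A)"

text \<open>The set \<open>\<B>\<close> selects the subalgebra: all blades, or only the even
  ones.\<close>

definition real_cl_group :: "nat \<Rightarrow> (nat \<Rightarrow> real) \<Rightarrow> nat set set \<Rightarrow> real \<Rightarrow> (nat set \<Rightarrow> real) set" where
  "real_cl_group n \<zeta> \<B> \<tau> = {u. (\<forall>A. A \<notin> \<B> \<longrightarrow> u A = 0) \<and>
      real_cl_mult n \<zeta> (real_cl_inv \<tau> u) u = (\<lambda>A. if A = {} then 1 else 0)}"

text \<open>This is what bijectivity rests on. Since \<open>cl_sign \<zeta> A A\<close> is the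
  square of the blade, \<open>D_adjoint\<close> makes each D A unitary; \<open>D_trace\<close> adds
  orthogonality; and \<open>card_\<B>\<close> equates the number of blades with the real dimension
  of the complex matrices over I.\<close>

locale blade_representation =
  fixes I :: "'a set" and n :: nat and \<zeta> :: "nat \<Rightarrow> real" and \<B> :: "nat set set"
    and D :: "nat set \<Rightarrow> 'a \<Rightarrow> 'a \<Rightarrow> complex"
  assumes I: "finite I"
    and \<zeta>: "a < n \<Longrightarrow> \<zeta> a * \<zeta> a = 1"
    and \<B>_subset: "A \<in> \<B> \<Longrightarrow> A \<subseteq> {..<n}"
    and \<B>_empty: "{} \<in> \<B>"
    and \<B>_symdiff: "A \<in> \<B> \<Longrightarrow> B \<in> \<B> \<Longrightarrow> symdiff A B \<in> \<B>"
    and card_\<B>: "card \<B> = 2 * (card I)\<^sup>2"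
    and D_in: "A \<in> \<B> \<Longrightarrow> D A \<in> fmats I"
    and D_empty: "D {} = fone I"
    and D_mult: "A \<in> \<B> \<Longrightarrow> B \<in> \<B> \<Longrightarrow>
        fmul I (D A) (D B) = fscale (of_real (cl_sign \<zeta> A B)) (D (symdiff A B))"
    and D_adjoint: "A \<in> \<B> \<Longrightarrow> fstar cnj (D A) = fscale (of_real (cl_sign \<zeta> A A)) (D A)"
    and D_trace: "A \<in> \<B> \<Longrightarrow> A \<noteq> {} \<Longrightarrow> Re (ftrace I (D A)) = 0"
begin

definition rep :: "(nat set \<Rightarrow> real) \<Rightarrow> 'a \<Rightarrow> 'a \<Rightarrow> complex" where
  "rep u = (\<lambda>s t. \<Sum>A\<in>\<B>. of_real (u A) * D A s t)"

text \<open>Orthogonal projection to the blades, each of which has squared norm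
  \<open>card I\<close>.\<close>

definition coeffs :: "('a \<Rightarrow> 'a \<Rightarrow> complex) \<Rightarrow> nat set \<Rightarrow> real" where
  "coeffs X = (\<lambda>A. if A \<in> \<B> then (\<Sum>s\<in>I. \<Sum>t\<in>I. Re (cnj (D A s t) * X s t)) / card I else 0)"

lemma fin_\<B>: "finite \<B>"
  by (rule finite_subset [of _ "Pow {..<n}"]) (use \<B>_subset in auto)

lemma card_I_pos: "card I > 0"
proof -
  have "card \<B> > 0" using fin_\<B> \<B>_empty by (auto simp: card_gt_0_iff)
  then show ?thesis using card_\<B> by (cases "card I") auto
qed

lemma cl_sign_self_square:
  assumes "A \<in> \<B>"
  shows "cl_sign \<zeta> A A * cl_sign \<zeta> A A = 1"
proof -
  have A: "finite A" "A \<subseteq> {..<n}" using assms \<B>_subset finite_subset by blast+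
  have "prod \<zeta> A * prod \<zeta> A = (\<Prod>a\<in>A. \<zeta> a * \<zeta> a)" by (simp add: prod.distrib)
  also have "\<dots> = 1" using A \<zeta> by (intro prod.neutral) auto
  finally have "prod \<zeta> A * prod \<zeta> A = 1" .
  then show ?thesis
    using rev_sign_square [of "card A"] unfolding cl_sign_self [OF A(1)] by (simp add: algebra_simps)
qed

text \<open>The product of the adjoint of D A with D B is, up to sign, the blade of the symmetric
  difference, which has a trace with nonzero real part only when it is empty.\<close>

lemma D_orthogonal:
  assumes "A \<in> \<B>" "B \<in> \<B>"
  shows "(\<Sum>s\<in>I. \<Sum>t\<in>I. Re (cnj (D A s t) * D B s t)) = (if A = B then card I else 0)"
proof -
  have "(\<Sum>s\<in>I. \<Sum>t\<in>I. Re (cnj (D A s t) * D B s t)) = Re (\<Sum>t\<in>I. \<Sum>s\<in>I. cnj (D A s t) * D B s t)"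
    by (subst sum.swap) simp
  also have "(\<Sum>t\<in>I. \<Sum>s\<in>I. cnj (D A s t) * D B s t) = ftrace I (fmul I (fstar cnj (D A)) (D B))"
    by (simp add: ftrace_def fmul_def fstar_def cong: sum.cong)
  also have "\<dots> = of_real (cl_sign \<zeta> A A * cl_sign \<zeta> A B) * ftrace I (D (symdiff A B))"
    using assms by (simp add: D_adjoint D_mult fmul_scale_left ftrace_fscale)
  finally have eq: "(\<Sum>s\<in>I. \<Sum>t\<in>I. Re (cnj (D A s t) * D B s t))
      = cl_sign \<zeta> A A * cl_sign \<zeta> A B * Re (ftrace I (D (symdiff A B)))"
    by simp
  show ?thesis
  proof (cases "A = B")
    case True
    then show ?thesis using eq cl_sign_self_square [OF assms(1)]
      by (simp add: D_empty ftrace_def fone_def cong: sum.cong)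
  next
    case False
    then have "Re (ftrace I (D (symdiff A B))) = 0"
      using assms by (intro D_trace \<B>_symdiff) simp_all
    then show ?thesis using eq False by simp
  qed
qed

lemma rep_in [simp]: "rep u \<in> fmats I"
  using D_in by (auto simp: rep_def fmats_def)

lemma coeffs_rep:
  assumes "\<And>A. A \<notin> \<B> \<Longrightarrow> u A = 0"
  shows "coeffs (rep u) = u"
proof
  fix A
  show "coeffs (rep u) A = u A"
  proof (cases "A \<in> \<B>")
    case True
    have "(\<Sum>s\<in>I. \<Sum>t\<in>I. Re (cnj (D A s t) * rep u s t))
       = (\<Sum>s\<in>I. \<Sum>t\<in>I. \<Sum>B\<in>\<B>. u B * Re (cnj (D A s t) * D B s t))"
      unfolding rep_def sum_distrib_left Re_sum by (intro sum.cong refl) (simp add: algebra_simps)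
    also have "\<dots> = (\<Sum>s\<in>I. \<Sum>B\<in>\<B>. \<Sum>t\<in>I. u B * Re (cnj (D A s t) * D B s t))"
      by (intro sum.cong refl sum.swap)
    also have "\<dots> = (\<Sum>B\<in>\<B>. u B * (\<Sum>s\<in>I. \<Sum>t\<in>I. Re (cnj (D A s t) * D B s t)))"
      by (subst sum.swap) (simp add: sum_distrib_left)
    also have "\<dots> = (\<Sum>B\<in>\<B>. if A = B then u B * card I else 0)"
      using True by (intro sum.cong refl) (simp only: D_orthogonal split: if_splits, simp)
    also have "\<dots> = u A * card I" using True fin_\<B> by simp
    finally show ?thesis using True card_I_pos by (simp add: coeffs_def)
  qed (simp add: coeffs_def assms)
qed

lemma rep_coeffs:
  assumes X: "X \<in> fmats I"
  shows "rep (coeffs X) = X"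
proof (intro ext)
  fix s t
  \<comment> \<open>Real and imaginary parts of the entries are separate columns. By the count of
    blades the real matrix Q is square, so orthogonality of its rows passes to its columns, and this
    gives the expansion of an arbitrary X.\<close>
  define Q where "Q A = (\<lambda>(s, t, b). if b then Re (D A s t) else Im (D A s t))" for A
  define x where "x = (\<lambda>(s, t, b). if b then Re (X s t) else Im (X s t))"
  define L where "L = I \<times> I \<times> (UNIV :: bool set)"
  have fin: "finite L" and card_L: "card \<B> = card L"
    using I by (auto simp: L_def card_\<B> card_cartesian_product power2_eq_square)
  have sum_L: "(\<Sum>l\<in>L. f l) = (\<Sum>s\<in>I. \<Sum>t\<in>I. f (s, t, True) + f (s, t, False))" for f :: "_ \<Rightarrow> real"
  proof -
    have "(\<Sum>l\<in>L. f l) = (\<Sum>s\<in>I. \<Sum>t\<in>I. \<Sum>b\<in>UNIV. f (s, t, b))"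
      unfolding L_def sum.cartesian_product by simp
    then show ?thesis by (simp add: UNIV_bool add.commute)
  qed
  have rows: "(\<Sum>l\<in>L. Q A l * Q B l) = (if A = B then real (card I) else 0)" if "A \<in> \<B>" "B \<in> \<B>" for A B
    using D_orthogonal [OF that] by (simp add: sum_L Q_def)
  have coeffs: "coeffs X A = (\<Sum>l\<in>L. Q A l * x l) / card I" if "A \<in> \<B>" for A
    using that by (simp add: coeffs_def sum_L Q_def x_def)
  have expand: "(\<Sum>A\<in>\<B>. coeffs X A * Q A m) = x m" if "m \<in> L" for m
  proof -
    have "(\<Sum>A\<in>\<B>. coeffs X A * Q A m) = (\<Sum>A\<in>\<B>. \<Sum>l\<in>L. x l * (Q A l * Q A m)) / card I"
      by (simp add: coeffs sum_distrib_right sum_distrib_left sum_divide_distrib algebra_simps)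
    also have "(\<Sum>A\<in>\<B>. \<Sum>l\<in>L. x l * (Q A l * Q A m)) = (\<Sum>l\<in>L. x l * (\<Sum>A\<in>\<B>. Q A l * Q A m))"
      by (subst sum.swap) (simp add: sum_distrib_left)
    also have "\<dots> = (\<Sum>l\<in>L. if l = m then x l * card I else 0)"
      using orthogonal_rows_imp_columns [OF fin_\<B> fin card_L rows] that by (intro sum.cong refl) auto
    also have "\<dots> = x m * card I" using that fin by simp
    finally show ?thesis using card_I_pos by simp
  qed
  show "rep (coeffs X) s t = X s t"
  proof (cases "s \<in> I \<and> t \<in> I")
    case True
    then show ?thesis using expand [of "(s, t, True)"] expand [of "(s, t, False)"]
      by (intro complex_eqI) (simp_all add: rep_def Q_def x_def L_def)
  next
    case False
    then show ?thesis using rep_in [of "coeffs X"] X by (auto simp: fmats_def)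
  qed
qed

lemma real_cl_mult_support:
  assumes "\<And>A. A \<notin> \<B> \<Longrightarrow> u A = 0" "\<And>A. A \<notin> \<B> \<Longrightarrow> v A = 0" "C \<notin> \<B>"
  shows "real_cl_mult n \<zeta> u v C = 0"
proof -
  have "u A * v (symdiff A C) = 0" for A
    using assms \<B>_symdiff [of A "symdiff A C"] by (cases "A \<in> \<B> \<and> symdiff A C \<in> \<B>") auto
  then have "u A * v (symdiff A C) * cl_sign \<zeta> A (symdiff A C) = 0" for A by simp
  then show ?thesis unfolding real_cl_mult_def by (simp only: sum.neutral_const if_cancel)
qed

lemma rep_mult:
  assumes u: "\<And>A. A \<notin> \<B> \<Longrightarrow> u A = 0"
  shows "rep (real_cl_mult n \<zeta> u v) = fmul I (rep u) (rep v)"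
proof (intro ext)
  fix s t
  have bij: "bij_betw (symdiff A) \<B> \<B>" if "A \<in> \<B>" for A
    using that by (intro bij_betw_byWitness [where f' = "symdiff A"]) (auto intro: \<B>_symdiff)
  have mult: "real_cl_mult n \<zeta> u v C = (\<Sum>A\<in>\<B>. u A * v (symdiff A C) * cl_sign \<zeta> A (symdiff A C))"
    if "C \<in> \<B>" for C
    unfolding real_cl_mult_def using \<B>_subset that u by (auto intro!: sum.mono_neutral_right)
  have "rep (real_cl_mult n \<zeta> u v) s t
      = (\<Sum>C\<in>\<B>. \<Sum>A\<in>\<B>. of_real (u A * v (symdiff A C) * cl_sign \<zeta> A (symdiff A C)) * D C s t)"
    unfolding rep_def by (intro sum.cong refl) (simp add: mult sum_distrib_right)
  also have "\<dots> = (\<Sum>A\<in>\<B>. \<Sum>C\<in>\<B>. complex_of_real (u A * v (symdiff A C) * cl_sign \<zeta> A (symdiff A C)) * D C s t)"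
    by (rule sum.swap)
  \<comment> \<open>For fixed A, substitute \<open>B = symdiff A C\<close>, an involution of
    \<open>\<B>\<close>.\<close>
  also have "\<dots> = (\<Sum>A\<in>\<B>. \<Sum>B\<in>\<B>. of_real (u A * v B * cl_sign \<zeta> A B) * D (symdiff A B) s t)"
  proof (rule sum.cong [OF refl])
    fix A assume "A \<in> \<B>"
    show "(\<Sum>C\<in>\<B>. of_real (u A * v (symdiff A C) * cl_sign \<zeta> A (symdiff A C)) * D C s t)
        = (\<Sum>B\<in>\<B>. of_real (u A * v B * cl_sign \<zeta> A B) * D (symdiff A B) s t)"
      using sum.reindex_bij_betw [OF bij [OF \<open>A \<in> \<B>\<close>],
          of "\<lambda>B. of_real (u A * v B * cl_sign \<zeta> A B) * D (symdiff A B) s t"] by simp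
  qed
  also have "\<dots> = (\<Sum>A\<in>\<B>. \<Sum>B\<in>\<B>. of_real (u A * v B) * fmul I (D A) (D B) s t)"
    by (intro sum.cong refl) (simp add: D_mult fscale_def)
  also have "\<dots> = fmul I (rep u) (rep v) s t"
  proof (cases "s \<in> I \<and> t \<in> I")
    case True
    have "(\<Sum>r\<in>I. rep u s r * rep v r t)
      = (\<Sum>r\<in>I. \<Sum>A\<in>\<B>. \<Sum>B\<in>\<B>. of_real (u A * v B) * (D A s r * D B r t))"
      by (simp add: rep_def sum_product mult_ac)
    also have "\<dots> = (\<Sum>A\<in>\<B>. \<Sum>B\<in>\<B>. of_real (u A * v B) * (\<Sum>r\<in>I. D A s r * D B r t))"
      by (subst sum.swap, rule sum.cong [OF refl], subst sum.swap) (simp add: sum_distrib_left)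
    finally show ?thesis using True by (simp add: fmul_def)
  qed (auto simp: fmul_def)
  finally show "rep (real_cl_mult n \<zeta> u v) s t = fmul I (rep u) (rep v) s t" .
qed

lemma rep_one: "rep (\<lambda>A. if A = {} then 1 else 0) = fone I"
proof (intro ext)
  fix s t
  have "rep (\<lambda>A. if A = {} then 1 else 0) s t = (\<Sum>A\<in>\<B>. if A = {} then D A s t else 0)"
    unfolding rep_def by (intro sum.cong) auto
  then show "rep (\<lambda>A. if A = {} then 1 else 0) s t = fone I s t"
    using fin_\<B> \<B>_empty by (simp add: D_empty)
qed

lemma fmul_rep_right: "fmul I S (rep u) = (\<lambda>s t. \<Sum>A\<in>\<B>. of_real (u A) * fmul I S (D A) s t)"
proof (intro ext)
  fix s t
  have "(\<Sum>r\<in>I. S s r * rep u r t) = (\<Sum>r\<in>I. \<Sum>A\<in>\<B>. of_real (u A) * (S s r * D A r t))"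
    by (simp add: rep_def sum_distrib_left mult_ac)
  also have "\<dots> = (\<Sum>A\<in>\<B>. of_real (u A) * (\<Sum>r\<in>I. S s r * D A r t))"
    by (subst sum.swap) (simp add: sum_distrib_left)
  finally show "fmul I S (rep u) s t = (\<Sum>A\<in>\<B>. of_real (u A) * fmul I S (D A) s t)"
    by (auto simp: fmul_def)
qed

lemma fmul_fstar_rep_left:
  assumes \<sigma>: "scalar_conj \<sigma>"
  shows "fmul I (fstar \<sigma> (rep u)) S = (\<lambda>s t. \<Sum>A\<in>\<B>. of_real (u A) * fmul I (fstar \<sigma> (D A)) S s t)"
proof (intro ext)
  fix s t
  have "(\<Sum>r\<in>I. fstar \<sigma> (rep u) s r * S r t) = (\<Sum>r\<in>I. \<Sum>A\<in>\<B>. of_real (u A) * (fstar \<sigma> (D A) s r * S r t))"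
    by (simp add: rep_def fstar_def scalar_conj_simps [OF \<sigma>] sum_distrib_left sum_distrib_right mult_ac)
  also have "\<dots> = (\<Sum>A\<in>\<B>. of_real (u A) * (\<Sum>r\<in>I. fstar \<sigma> (D A) s r * S r t))"
    by (subst sum.swap) (simp add: sum_distrib_left)
  finally show "fmul I (fstar \<sigma> (rep u)) S s t = (\<Sum>A\<in>\<B>. of_real (u A) * fmul I (fstar \<sigma> (D A)) S s t)"
    by (auto simp: fmul_def)
qed

text \<open>By linearity \<open>SD\<close> says that S intertwines the anti-involution with the
  star. Multiplying \<open>\<tau>(u) u = 1\<close> by S from the left therefore gives exactly the
  isometry equation.\<close>

theorem real_cl_group_iso_form_group:
  assumes \<sigma>: "scalar_conj \<sigma>"
    and S: "S \<in> fmats I" "S' \<in> fmats I" "fmul I S' S = fone I"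
    and SD: "\<And>A. A \<in> \<B> \<Longrightarrow>
      fscale (of_real (rev_sign (card A) * \<tau> ^ card A)) (fmul I S (D A)) = fmul I (fstar \<sigma> (D A)) S"
  shows "lie_iso (real_cl_group n \<zeta> \<B> \<tau>) (real_cl_mult n \<zeta>) (form_group I \<sigma> S) (fmul I)"
proof -
  note assoc = fmul_assoc [OF I]
  have SF: "fmul I S (rep (real_cl_inv \<tau> u)) = fmul I (fstar \<sigma> (rep u)) S" for u
    unfolding fmul_rep_right fmul_fstar_rep_left [OF \<sigma>]
    by (intro ext sum.cong refl) (simp add: SD [symmetric] real_cl_inv_def fscale_def mult_ac)
  show ?thesis
  proof (rule lie_isoI [where f = rep and g = coeffs])
    show "rep u \<in> form_group I \<sigma> S" if "u \<in> real_cl_group n \<zeta> \<B> \<tau>" for u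
    proof -
      have "fmul I (rep (real_cl_inv \<tau> u)) (rep u) = rep (real_cl_mult n \<zeta> (real_cl_inv \<tau> u) u)"
        using that by (intro rep_mult [symmetric]) (auto simp: real_cl_group_def real_cl_inv_def)
      also have "\<dots> = fone I"
        using that by (simp add: rep_one real_cl_group_def)
      finally have "fmul I S (fmul I (rep (real_cl_inv \<tau> u)) (rep u)) = S"
        by (simp add: fmul_one_right I S)
      then show ?thesis by (simp add: assoc [symmetric] SF form_group_def)
    qed
    show "coeffs X \<in> real_cl_group n \<zeta> \<B> \<tau>" if "X \<in> form_group I \<sigma> S" for X
    proof -
      let ?u = "coeffs X" and ?e = "\<lambda>A :: nat set. if A = {} then 1 else 0 :: real"
      have X: "rep ?u = X" using that by (auto simp: form_group_def rep_coeffs)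
      have supp: "?u A = 0" "real_cl_inv \<tau> ?u A = 0" if "A \<notin> \<B>" for A
        using that by (auto simp: coeffs_def real_cl_inv_def)
      have "fmul I S (fmul I (rep (real_cl_inv \<tau> ?u)) (rep ?u)) = S"
        using that by (simp add: assoc [symmetric] SF X form_group_def)
      \<comment> \<open>For the converse, S is cancelled by its left inverse.\<close>
      then have "fmul I (fmul I S' S) (fmul I (rep (real_cl_inv \<tau> ?u)) (rep ?u)) = fmul I S' S"
        by (simp add: assoc)
      then have "rep (real_cl_mult n \<zeta> (real_cl_inv \<tau> ?u) ?u) = rep ?e"
        by (simp add: S fmul_one_left I rep_one rep_mult supp)
      then have "coeffs (rep (real_cl_mult n \<zeta> (real_cl_inv \<tau> ?u) ?u)) = coeffs (rep ?e)" by simp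
      \<comment> \<open>\<open>coeffs\<close> recovers only coordinates supported in
        \<open>\<B>\<close>; the product is supported there because \<open>\<B>\<close> is closed
        under symmetric difference.\<close>
      then have "real_cl_mult n \<zeta> (real_cl_inv \<tau> ?u) ?u = ?e"
        using \<B>_empty by (subst (asm) (1 2) coeffs_rep) (auto simp: real_cl_mult_support supp)
      then show ?thesis by (simp add: real_cl_group_def supp)
    qed
    show "coeffs (rep u) = u" if "u \<in> real_cl_group n \<zeta> \<B> \<tau>" for u
      using that by (intro coeffs_rep) (auto simp: real_cl_group_def)
    show "rep (coeffs X) = X" if "X \<in> form_group I \<sigma> S" for X
      using that by (intro rep_coeffs) (auto simp: form_group_def)
    show "rep (real_cl_mult n \<zeta> u v) = fmul I (rep u) (rep v)" if "u \<in> real_cl_group n \<zeta> \<B> \<tau>" for u v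
      using that by (intro rep_mult) (auto simp: real_cl_group_def)
    show "continuous_on (real_cl_group n \<zeta> \<B> \<tau>) rep"
      unfolding rep_def by (intro continuous_on_matrixI continuous_intros continuous_on_coord)
    have "continuous_on G (\<lambda>X. coeffs X A)" for G A
    proof (cases "A \<in> \<B>")
      case True
      have "continuous_on G (\<lambda>X. (\<Sum>s\<in>I. \<Sum>t\<in>I. Re (cnj (D A s t) * X s t)) / card I)"
        using card_I_pos by (intro continuous_intros continuous_on_entry) simp
      then show ?thesis using True by (simp add: coeffs_def)
    qed (simp add: coeffs_def)
    then show "continuous_on (form_group I \<sigma> S) coeffs"
      by (intro continuous_on_coordinatewise_then_product)
  qed
qed

end

subsection \<open>Jordan-Wigner matrices and spin representations\<close>

text \<open>The pairs in \<open>A \<times> B\<close> split into inversions of AB, inversions of BA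
  and the diagonal.\<close>

lemma cl_sign_commute:
  assumes "finite A" "finite B"
  shows "cl_sign \<zeta> B A = (-1) ^ (card A * card B + card (A \<inter> B)) * cl_sign \<zeta> A B"
proof -
  let ?l = "{(a, b). a \<in> A \<and> b \<in> B \<and> b < a}" and ?g = "{(b, a). b \<in> B \<and> a \<in> A \<and> a < b}"
  have "A \<times> B = (?l \<union> prod.swap ` ?g) \<union> (\<lambda>a. (a, a)) ` (A \<inter> B)"
    by (auto simp: image_iff)
  also have "card \<dots> = card (?l \<union> prod.swap ` ?g) + card ((\<lambda>a. (a, a)) ` (A \<inter> B))"
    using assms by (intro card_Un_disjoint finite_UnI finite_imageI finite_inversions) auto
  also have "card (?l \<union> prod.swap ` ?g) = card ?l + card (prod.swap ` ?g)"
    using assms by (intro card_Un_disjoint finite_imageI finite_inversions) auto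
  also have "card (prod.swap ` ?g) = card ?g" by (intro card_image) (auto simp: inj_on_def)
  also have "card ((\<lambda>a. (a, a)) ` (A \<inter> B)) = card (A \<inter> B)" by (intro card_image) (auto simp: inj_on_def)
  finally have "card A * card B = card ?l + card ?g + card (A \<inter> B)" by (simp add: card_cartesian_product)
  then have "even (card ?g) \<longleftrightarrow> even (card A * card B + card (A \<inter> B) + card ?l)" by presburger
  then have "(-1::real) ^ card ?g = (-1) ^ (card A * card B + card (A \<inter> B)) * (-1) ^ card ?l"
    by (simp add: minus_one_power_iff flip: power_add)
  moreover have "(\<Prod>a\<in>A \<inter> B. \<zeta> a) = (\<Prod>a\<in>B \<inter> A. \<zeta> a)" by (simp add: Int_commute)
  ultimately show ?thesis unfolding cl_sign_def by (simp only: mult.assoc)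
qed

lemma card_involution_half:
  assumes "finite X" "\<And>x. x \<in> X \<Longrightarrow> f x \<in> X" "\<And>x. x \<in> X \<Longrightarrow> f (f x) = x"
    and "\<And>x. x \<in> X \<Longrightarrow> P (f x) \<longleftrightarrow> \<not> P x"
  shows "2 * card {x \<in> X. P x} = card X"
proof -
  have "bij_betw f {x \<in> X. P x} {x \<in> X. \<not> P x}"
    by (rule bij_betw_byWitness [where f' = f]) (use assms in auto)
  then have "card {x \<in> X. P x} = card {x \<in> X. \<not> P x}" by (rule bij_betw_same_card)
  moreover have "card X = card {x \<in> X. P x} + card {x \<in> X. \<not> P x}"
    using assms(1) by (subst card_Un_disjoint [symmetric]) (auto intro: arg_cong [where f = card])
  ultimately show ?thesis by simp
qed

lemma card_even_subsets:
  assumes "m > 0"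
  shows "card {A. A \<subseteq> {..<m} \<and> even (card A)} = 2 ^ (m - 1)"
proof -
  have "2 * card {A \<in> Pow {..<m}. even (card A)} = card (Pow {..<m})"
  proof (rule card_involution_half [where f = "\<lambda>A. symdiff A {0}"])
    fix A assume "A \<in> Pow {..<m}"
    then have "finite A" by (auto intro: finite_subset)
    then show "even (card (symdiff A {0})) \<longleftrightarrow> \<not> even (card A)" by (simp add: even_card_symdiff)
    show "symdiff A {0} \<in> Pow {..<m}" using assms \<open>A \<in> _\<close> by (auto simp: symdiff_def)
    show "symdiff (symdiff A {0}) {0} = A" by (simp add: symdiff_assoc)
  qed simp
  then show ?thesis using assms by (cases m) (simp_all add: card_Pow)
qed

text \<open>The operator \<open>X\<^sup>x Z\<^sup>z\<close> on K qubits: a basis vector is the set t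
  of its raised bits, the signs z act first, then the bits in x are flipped. All entries are
  real.\<close>

definition pauli :: "nat \<Rightarrow> nat set \<Rightarrow> nat set \<Rightarrow> nat set \<Rightarrow> nat set \<Rightarrow> complex" where
  "pauli K x z = (\<lambda>s t. if t \<subseteq> {..<K} \<and> s = symdiff t x then (-1) ^ card (t \<inter> z) else 0)"

lemma pauli_in: "x \<subseteq> {..<K} \<Longrightarrow> pauli K x z \<in> fmats (Pow {..<K})"
  using symdiff_subset [of _ "{..<K}" x] by (fastforce simp: fmats_def pauli_def)

text \<open>The sign comes from moving the flips x' to the left of the phases z.\<close>

lemma pauli_mult:
  assumes x: "x \<subseteq> {..<K}" "x' \<subseteq> {..<K}"
  shows "fmul (Pow {..<K}) (pauli K x z) (pauli K x' z')
    = fscale ((-1) ^ card (x' \<inter> z)) (pauli K (symdiff x x') (symdiff z z'))"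
proof (intro ext)
  fix s t
  show "fmul (Pow {..<K}) (pauli K x z) (pauli K x' z') s t
    = fscale ((-1) ^ card (x' \<inter> z)) (pauli K (symdiff x x') (symdiff z z')) s t"
  proof (cases "s \<subseteq> {..<K} \<and> t \<subseteq> {..<K}")
    case True
    then have fin: "finite t" "finite x'" using x by (auto intro: finite_subset)
    have tx: "symdiff t x' \<subseteq> {..<K}" using True x by (intro symdiff_subset) auto
    have "(\<Sum>r\<in>Pow {..<K}. pauli K x z s r * pauli K x' z' r t)
        = (\<Sum>r\<in>Pow {..<K}. if r = symdiff t x' then pauli K x z s (symdiff t x') * (-1) ^ card (t \<inter> z') else 0)"
      using True by (intro sum.cong refl) (auto simp: pauli_def)
    also have "\<dots> = pauli K x z s (symdiff t x') * (-1) ^ card (t \<inter> z')"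
      using tx by simp
    also have "\<dots> = (if s = symdiff t (symdiff x x')
         then (-1) ^ card (t \<inter> z) * (-1) ^ card (x' \<inter> z) * (-1) ^ card (t \<inter> z') else 0)"
      using tx by (simp add: pauli_def minus_one_power_card_symdiff_Int [OF fin] symdiff_assoc symdiff_commute [of x])
    also have "(-1) ^ card (t \<inter> z) * (-1) ^ card (t \<inter> z') = ((-1) ^ card (t \<inter> symdiff z z') :: complex)"
    proof -
      have "t \<inter> symdiff z z' = symdiff (t \<inter> z) (t \<inter> z')" by (auto simp: symdiff_def)
      then have "even (card (t \<inter> symdiff z z')) \<longleftrightarrow> even (card (t \<inter> z) + card (t \<inter> z'))"
        using fin by (simp add: even_card_symdiff)
      then show ?thesis unfolding power_add [symmetric] by (metis minus_one_power_iff)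
    qed
    then have "(if s = symdiff t (symdiff x x')
         then (-1) ^ card (t \<inter> z) * (-1) ^ card (x' \<inter> z) * (-1) ^ card (t \<inter> z') else 0)
       = fscale ((-1) ^ card (x' \<inter> z)) (pauli K (symdiff x x') (symdiff z z')) s t"
      using True by (simp add: fscale_def pauli_def mult_ac)
    finally show ?thesis using True by (simp add: fmul_def)
  next
    case False
    then show ?thesis using symdiff_subset [OF _ symdiff_subset [OF x]]
      by (auto simp: fmul_def fscale_def pauli_def)
  qed
qed

text \<open>Flips and phases are symmetric, so the star only reverses their order. The entries being
  real, adjoint and transpose agree.\<close>

lemma fstar_pauli:
  assumes \<sigma>: "scalar_conj \<sigma>" and x: "x \<subseteq> {..<K}"
  shows "fstar \<sigma> (pauli K x z) = fscale ((-1) ^ card (x \<inter> z)) (pauli K x z)"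
proof (intro ext)
  fix s t
  have \<sigma>1: "\<sigma> ((-1) ^ m) = (-1) ^ m" for m using \<sigma> by (auto simp: scalar_conj_def)
  have eq: "s \<subseteq> {..<K} \<and> t = symdiff s x \<longleftrightarrow> t \<subseteq> {..<K} \<and> s = symdiff t x"
    using symdiff_subset [OF _ x] by (auto simp: symdiff_assoc)
  have "(-1) ^ card (s \<inter> z) = ((-1) ^ card (x \<inter> z) * (-1) ^ card (t \<inter> z) :: complex)"
    if "t \<subseteq> {..<K}" "s = symdiff t x"
    using minus_one_power_card_symdiff_Int [of t x z] that x by (simp add: finite_subset mult.commute)
  then show "fstar \<sigma> (pauli K x z) s t = fscale ((-1) ^ card (x \<inter> z)) (pauli K x z) s t"
    using eq by (simp add: fstar_def fscale_def pauli_def \<sigma>1 scalar_conj_simps [OF \<sigma>])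
qed

text \<open>The exponent is the symplectic form of the binary vectors (x, z) and (x', z').\<close>

lemma pauli_commute:
  assumes x: "x \<subseteq> {..<K}" "x' \<subseteq> {..<K}"
  shows "fmul (Pow {..<K}) (pauli K x z) (pauli K x' z')
    = fscale ((-1) ^ (card (x' \<inter> z) + card (x \<inter> z'))) (fmul (Pow {..<K}) (pauli K x' z') (pauli K x z))"
  unfolding pauli_mult [OF x] pauli_mult [OF x(2,1)] fscale_fscale
  by (simp add: symdiff_commute [of x'] symdiff_commute [of z'] power_add mult.assoc flip: power_mult_distrib)

text \<open>Jordan-Wigner: the matrix with number \<open>a\<close> flips the bit \<open>a div 2\<close>, with the parity of the lower
bits (for odd \<open>a\<close> including bit \<open>a div 2\<close>) as phase; number \<open>2 * K\<close> is the total parity.\<close>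
definition jw_flip :: "nat \<Rightarrow> nat \<Rightarrow> nat set" where
  "jw_flip K a = (if a < 2 * K then {a div 2} else {})"

definition jw_phase :: "nat \<Rightarrow> nat set" where
  "jw_phase a = {..<(a + 1) div 2}"

definition jw :: "nat \<Rightarrow> nat \<Rightarrow> nat set \<Rightarrow> nat set \<Rightarrow> complex" where
  "jw K a = pauli K (jw_flip K a) (jw_phase a)"

lemma jw_flip_subset: "jw_flip K a \<subseteq> {..<K}"
  by (auto simp: jw_flip_def)

text \<open>A flipped bit lies in its own phase set exactly for odd a. This one parity gives both
  the square and the symmetry of the matrix.\<close>

lemma card_jw_flip_phase: "a \<le> 2 * K \<Longrightarrow> (-1::complex) ^ card (jw_flip K a \<inter> jw_phase a) = (-1) ^ a"
  by (auto simp: jw_flip_def jw_phase_def minus_one_power_iff elim: oddE evenE)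

lemma jw_in: "jw K a \<in> fmats (Pow {..<K})"
  unfolding jw_def by (intro pauli_in jw_flip_subset)

lemma jw_square:
  assumes "a \<le> 2 * K"
  shows "fmul (Pow {..<K}) (jw K a) (jw K a) = fscale ((-1) ^ a) (fone (Pow {..<K}))"
proof -
  have "pauli K {} {} = fone (Pow {..<K})" by (auto simp: pauli_def fone_def fun_eq_iff)
  then show ?thesis
    unfolding jw_def pauli_mult [OF jw_flip_subset jw_flip_subset] by (simp add: card_jw_flip_phase [OF assms])
qed

text \<open>For a < b the bit of a lies in the phase set of b, but the bit of b, if any, lies beyond
  the phase set of a.\<close>

lemma jw_flip_Int_phase:
  assumes "a \<noteq> b" "a \<le> 2 * K" "b \<le> 2 * K"
  shows "card (jw_flip K b \<inter> jw_phase a) + card (jw_flip K a \<inter> jw_phase b) = 1"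
proof -
  have "card (jw_flip K b \<inter> jw_phase a) = 0 \<and> card (jw_flip K a \<inter> jw_phase b) = 1" if "a < b" "b \<le> 2 * K" for a b
  proof -
    have "jw_flip K b \<inter> jw_phase a = {}" using that by (auto simp: jw_flip_def jw_phase_def)
    moreover have "jw_flip K a \<inter> jw_phase b = {a div 2}" using that by (auto simp: jw_flip_def jw_phase_def)
    ultimately show ?thesis by simp
  qed
  from this [of a b] this [of b a] show ?thesis using assms by (cases "a < b") auto
qed

lemma jw_anticomm:
  assumes "a \<noteq> b" "a \<le> 2 * K" "b \<le> 2 * K"
  shows "fmul (Pow {..<K}) (jw K a) (jw K b) = fscale (-1) (fmul (Pow {..<K}) (jw K b) (jw K a))"
  unfolding jw_def by (subst pauli_commute) (simp_all add: jw_flip_subset jw_flip_Int_phase [OF assms])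

lemma fstar_jw:
  assumes "scalar_conj \<sigma>" "a \<le> 2 * K"
  shows "fstar \<sigma> (jw K a) = fscale ((-1) ^ a) (jw K a)"
  unfolding jw_def by (simp add: fstar_pauli [OF assms(1) jw_flip_subset] card_jw_flip_phase assms)

text \<open>The hypothesis on Y says that Y leaves the span of I invariant.\<close>

lemma frestrict_fmul:
  assumes "I \<subseteq> J" "finite J" "\<And>r t. r \<in> J \<Longrightarrow> r \<notin> I \<Longrightarrow> t \<in> I \<Longrightarrow> Y r t = 0"
  shows "frestrict I (fmul J X Y) = fmul I (frestrict I X) (frestrict I Y)"
proof (intro ext)
  fix s t
  have "(\<Sum>r\<in>J. X s r * Y r t) = (\<Sum>r\<in>I. X s r * Y r t)" if "t \<in> I"
    using assms that by (intro sum.mono_neutral_right) auto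
  then show "frestrict I (fmul J X Y) s t = fmul I (frestrict I X) (frestrict I Y) s t"
    using assms(1) by (auto simp: frestrict_def fmul_def)
qed

lemma frestrict_fscale: "frestrict I (fscale c X) = fscale c (frestrict I X)"
  by (auto simp: frestrict_def fscale_def fun_eq_iff)

lemma frestrict_fstar: "scalar_conj \<sigma> \<Longrightarrow> frestrict I (fstar \<sigma> X) = fstar \<sigma> (frestrict I X)"
  by (auto simp: frestrict_def fstar_def fun_eq_iff scalar_conj_simps)

lemma frestrict_fone: "I \<subseteq> J \<Longrightarrow> frestrict I (fone J) = fone I"
  by (auto simp: frestrict_def fone_def fun_eq_iff)

text \<open>For \<open>ev\<close>, only the even blades in an even number of generators are represented, on one of the two
half-spin spaces (spanned by the subsets of even cardinality).\<close>
definition spin_index :: "nat \<Rightarrow> bool \<Rightarrow> nat set set" where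
  "spin_index K ev = {s. s \<subseteq> {..<K} \<and> (ev \<longrightarrow> even (card s))}"

definition blade_index :: "nat \<Rightarrow> bool \<Rightarrow> nat set set" where
  "blade_index n ev = {A. A \<subseteq> {..<n} \<and> (ev \<longrightarrow> even (card A))}"

text \<open>Reversing 2K or 2K + 1 letters has sign \<open>(-1) ^ K\<close>, so
  \<open>odd_negatives\<close> states that the full blade squares to -1. The permutation
  \<open>\<pi>\<close> says which Jordan-Wigner matrix represents which generator.\<close>

locale jw_clifford =
  fixes K :: nat and ev :: bool and n :: nat and \<zeta> :: "nat \<Rightarrow> real" and \<pi> :: "nat \<Rightarrow> nat"
  assumes n_eq: "n = (if ev then 2 * K else 2 * K + 1)" and n_pos: "n > 0"
    and \<zeta>_cases: "a < n \<Longrightarrow> \<zeta> a = 1 \<or> \<zeta> a = -1"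
    and \<pi>_bij: "bij_betw \<pi> {..<n} {..<n}"
    and odd_negatives: "odd (K + card {a. a < n \<and> \<zeta> a = -1})"
begin

abbreviation "J \<equiv> Pow {..<K}"
abbreviation "I \<equiv> spin_index K ev"
abbreviation "\<B> \<equiv> blade_index n ev"

definition gen_scalar :: "nat \<Rightarrow> complex" where
  "gen_scalar a = (if \<zeta> a = (-1) ^ \<pi> a then 1 else \<i>)"

definition gen :: "nat \<Rightarrow> nat set \<Rightarrow> nat set \<Rightarrow> complex" where
  "gen a = fscale (gen_scalar a) (jw K (\<pi> a))"

definition D :: "nat set \<Rightarrow> nat set \<Rightarrow> nat set \<Rightarrow> complex" where
  "D A = frestrict I (blade J gen n A)"

lemma \<pi>_less: "a < n \<Longrightarrow> \<pi> a < n"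
  using bij_betw_apply [OF \<pi>_bij] by simp

lemma \<pi>_le: "a < n \<Longrightarrow> \<pi> a \<le> 2 * K"
  using \<pi>_less [of a] n_eq by (simp split: if_splits)

lemma gen_scalar_square:
  assumes "a < n"
  shows "gen_scalar a * gen_scalar a * (-1) ^ \<pi> a = of_real (\<zeta> a)"
  using \<zeta>_cases [OF assms] by (cases "even (\<pi> a)") (auto simp: gen_scalar_def)

text \<open>The scalar part of a simple fact: a unitary matrix whose square is the sign
  \<open>\<zeta> a\<close> has itself times \<open>\<zeta> a\<close> as adjoint.\<close>

lemma gen_scalar_cnj:
  assumes "a < n"
  shows "cnj (gen_scalar a) * (-1) ^ \<pi> a = of_real (\<zeta> a) * gen_scalar a"
  using \<zeta>_cases [OF assms] by (cases "even (\<pi> a)") (auto simp: gen_scalar_def)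

sublocale clifford_family J gen n \<zeta>
proof
  fix a b assume ab: "a < n"
  show "gen a \<in> fmats J" by (simp add: gen_def jw_in)
  show "fmul J (gen a) (gen a) = fscale (of_real (\<zeta> a)) (fone J)"
    using ab by (simp add: gen_def fmul_scale_left fmul_scale_right fscale_fscale jw_square \<pi>_le
        gen_scalar_square [symmetric] mult.assoc)
  assume b: "b < n" "a \<noteq> b"
  then have "\<pi> a \<noteq> \<pi> b" using \<pi>_bij ab by (auto simp: bij_betw_def inj_on_def)
  then have "fmul J (jw K (\<pi> a)) (jw K (\<pi> b)) = fscale (-1) (fmul J (jw K (\<pi> b)) (jw K (\<pi> a)))"
    using ab b by (intro jw_anticomm \<pi>_le)
  then show "fmul J (gen a) (gen b) = fscale (-1) (fmul J (gen b) (gen a))"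
    by (simp add: gen_def fmul_scale_left fmul_scale_right fscale_fscale mult_ac)
qed simp

text \<open>Each generator flips exactly one bit: in the even case n = 2K, so the parity matrix with
  number 2K, which flips none, does not occur.\<close>

lemma blade_parity:
  "ev \<Longrightarrow> k \<le> n \<Longrightarrow> A \<subseteq> {..<k} \<Longrightarrow> s \<in> J \<Longrightarrow> t \<in> J \<Longrightarrow> blade J gen k A s t \<noteq> 0 \<Longrightarrow>
    even (card s) \<longleftrightarrow> even (card t + card A)"
proof (induction k arbitrary: A s t)
  case 0
  then show ?case by (simp add: fone_def split: if_splits)
next
  case (Suc k)
  from Suc.prems(3) show ?case
  proof (cases rule: subset_lessThan_Suc_cases)
    case 1
    then show ?thesis using Suc by (simp add: blade_Suc_subset del: blade.simps)
  next
    case (2 A')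
    then have fin: "finite A'" "k \<notin> A'" by (auto intro: finite_subset)
    have "(\<Sum>r\<in>J. blade J gen k A' s r * gen k r t) \<noteq> 0"
      using Suc.prems 2 by (simp add: blade_Suc_insert fmul_def del: blade.simps)
    then obtain r where r: "r \<in> J" "blade J gen k A' s r \<noteq> 0" "gen k r t \<noteq> 0"
      by (metis (no_types, lifting) mult_zero_left mult_zero_right sum.neutral)
    then have "even (card s) \<longleftrightarrow> even (card r + card A')"
      using Suc 2 by simp
    moreover have "r = symdiff t {\<pi> k div 2}"
      using r(3) \<pi>_less [of k] Suc.prems n_eq
      by (auto simp: gen_def fscale_def jw_def pauli_def jw_flip_def split: if_splits)
    moreover have "finite t" using Suc.prems by (auto intro: finite_subset)
    ultimately show ?thesis using 2 fin by (auto simp: even_card_symdiff)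
  qed
qed

lemma I_subset: "I \<subseteq> J"
  by (auto simp: spin_index_def)

lemma blade_preserves_I:
  assumes "A \<in> \<B>" "r \<in> J" "r \<notin> I" "t \<in> I"
  shows "blade J gen n A r t = 0"
  using assms blade_parity [of n A r t] by (auto simp: spin_index_def blade_index_def)

lemma card_I: "card I = 2 ^ (if ev then K - 1 else K)"
  using n_pos n_eq card_even_subsets [of K]
  by (auto simp: spin_index_def card_Pow simp flip: Pow_def)

text \<open>There are \<open>2 ^ (2 * K + 1)\<close> blades for \<open>2 ^ K\<close> states; in the
  even case \<open>2 ^ (2 * K - 1)\<close> blades for \<open>2 ^ (K - 1)\<close> states.\<close>

lemma card_\<B>: "card \<B> = 2 * (card I)\<^sup>2"
proof (cases ev)
  case True
  then obtain m where "K = Suc m" using n_pos n_eq by (cases K) auto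
  then show ?thesis using True card_even_subsets [of n] card_I n_eq
    by (simp add: blade_index_def power_mult [symmetric] mult.commute)
next
  case False
  then show ?thesis using card_I n_eq
    by (simp add: blade_index_def card_Pow power_mult [symmetric] mult.commute flip: Pow_def)
qed

lemma D_mult:
  assumes "A \<in> \<B>" "B \<in> \<B>"
  shows "fmul I (D A) (D B) = fscale (of_real (cl_sign \<zeta> A B)) (D (symdiff A B))"
proof -
  have "fmul I (D A) (D B) = frestrict I (fmul J (blade J gen n A) (blade J gen n B))"
    unfolding D_def by (intro frestrict_fmul [symmetric] I_subset J blade_preserves_I [OF assms(2)])
  then show ?thesis
    using assms by (simp add: blade_fmul_blade blade_index_def frestrict_fscale D_def)
qed

lemma cl_sign_full: "cl_sign \<zeta> {..<n} {..<n} = -1"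
proof -
  have "prod \<zeta> {..<n} = (\<Prod>a<n. if \<zeta> a = -1 then -1 else 1)"
    using \<zeta>_cases by (intro prod.cong) auto
  also have "\<dots> = (-1) ^ card {a. a < n \<and> \<zeta> a = -1}"
    by (simp add: prod.If_cases Int_def)
  finally have prod: "prod \<zeta> {..<n} = (-1) ^ card {a. a < n \<and> \<zeta> a = -1}" .
  have "rev_sign n = (-1) ^ K"
  proof (cases ev)
    case True
    then have "n * (n - 1) div 2 = K * (2 * K - 1)" using n_eq by simp
    then show ?thesis using True n_pos n_eq by (auto simp: rev_sign_def minus_one_power_iff)
  next
    case False
    then have "n * (n - 1) div 2 = (2 * K + 1) * K" using n_eq by simp
    then show ?thesis by (auto simp: rev_sign_def minus_one_power_iff)
  qed
  then show ?thesis
    using odd_negatives by (simp add: cl_sign_self prod flip: power_add)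
qed

lemma cl_sign_self_nonzero: "A \<subseteq> {..<n} \<Longrightarrow> cl_sign \<zeta> A A \<noteq> 0"
  using \<zeta>_cases by (force simp: cl_sign_self finite_subset rev_sign_def)

lemma D_adjoint:
  assumes "A \<in> \<B>"
  shows "fstar cnj (D A) = fscale (of_real (cl_sign \<zeta> A A)) (D A)"
proof -
  have A: "A \<subseteq> {..<n}" "finite A" using assms by (auto simp: blade_index_def intro: finite_subset)
  have cnj: "scalar_conj cnj" by (simp add: scalar_conj_def)
  have "fstar cnj (gen a) = fscale (of_real (\<zeta> a)) (gen a)" if "a < n" for a
    using gen_scalar_cnj [OF that] that
    by (simp add: gen_def fstar_fscale [OF cnj] fstar_jw [OF cnj] \<pi>_le fscale_fscale)
  from fstar_blade [OF cnj this order_refl A(1)] show ?thesis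
    by (simp add: D_def frestrict_fstar [OF cnj, symmetric] frestrict_fscale cl_sign_self A)
qed

text \<open>A proper nonempty blade anticommutes with the invertible even blade on one index inside and one outside it.\<close>
lemma D_trace:
  assumes C: "C \<in> \<B>" "C \<noteq> {}"
  shows "Re (ftrace I (D C)) = 0"
proof (cases "C = {..<n}")
  case True
  \<comment> \<open>The full blade is anti-Hermitian, so its diagonal is imaginary; only the real
    part of its trace vanishes.\<close>
  have "D C s s + cnj (D C s s) = 0" for s
    using fun_cong [OF fun_cong [OF D_adjoint [OF C(1)], of s], of s]
    by (simp add: fstar_def fscale_def True cl_sign_full)
  then have "Re (D C s s) = 0" for s by (simp add: complex_eq_iff)
  then show ?thesis by (simp add: ftrace_def)
next
  case False
  have Cn: "C \<subseteq> {..<n}" "finite C" using C by (auto simp: blade_index_def intro: finite_subset)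
  obtain b c where bc: "b \<in> C" "c < n" "c \<notin> C" using C(2) False Cn by blast
  define E where "E = {b, c}"
  have E: "E \<subseteq> {..<n}" "finite E" "card E = 2" "E \<inter> C = {b}" using bc Cn by (auto simp: E_def card_insert_if)
  then have E\<B>: "E \<in> \<B>" by (simp add: blade_index_def)
  have fin: "finite I" using I_subset by (rule finite_subset) simp
  have "fmul I (D C) (D E) = fscale (-1) (fmul I (D E) (D C))"
    using cl_sign_commute [OF E(2) Cn(2), of \<zeta>] C(1) E\<B> E
    by (simp add: D_mult fscale_fscale symdiff_commute [of C])
  \<comment> \<open>By cyclicity both products have the same trace up to the sign just found, so
    that trace is 0; and the square of D E is a nonzero scalar.\<close>
  then have "fmul I (fmul I (D E) (D C)) (D E) = fscale (-1) (fmul I (fmul I (D E) (D E)) (D C))"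
    by (simp add: fmul_assoc [OF fin] fmul_scale_right)
  then have "ftrace I (fmul I (fmul I (D E) (D C)) (D E)) = - ftrace I (fmul I (fmul I (D E) (D E)) (D C))"
    by (simp add: ftrace_fscale)
  moreover have "ftrace I (fmul I (fmul I (D E) (D C)) (D E)) = ftrace I (fmul I (fmul I (D E) (D E)) (D C))"
    by (subst ftrace_fmul_commute) (simp add: fmul_assoc [OF fin])
  moreover have "fmul I (fmul I (D E) (D E)) (D C) = fscale (of_real (cl_sign \<zeta> E E)) (D C)"
    using E\<B> C(1) by (simp add: D_mult fmul_scale_left) (simp add: D_def I_subset frestrict_fone fmul_one_left fin)
  ultimately have "ftrace I (D C) = 0"
    using cl_sign_self_nonzero [OF E(1)] by (simp add: ftrace_fscale)
  then show ?thesis by simp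
qed

sublocale blade_representation I n \<zeta> \<B> D
proof
  show "finite I" using I_subset by (rule finite_subset) simp
  show "\<zeta> a * \<zeta> a = 1" if "a < n" for a using \<zeta>_cases [OF that] by auto
  show "A \<subseteq> {..<n}" if "A \<in> \<B>" for A using that by (simp add: blade_index_def)
  show "{} \<in> \<B>" by (simp add: blade_index_def)
  show "symdiff A B \<in> \<B>" if "A \<in> \<B>" "B \<in> \<B>" for A B
    using that symdiff_subset [of A "{..<n}" B]
    by (auto simp: blade_index_def even_card_symdiff finite_subset)
  show "D A \<in> fmats I" for A by (simp add: D_def)
  show "D {} = fone I" by (simp add: D_def frestrict_fone I_subset)
qed (fact card_\<B> D_mult D_adjoint D_trace)+

text \<open>The intertwining relation needs checking on generators only. The star multiplies a
  generator by \<open>\<epsilon> a\<close>: by its square for the adjoint, and by the symmetry sign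
  of its Jordan-Wigner matrix for the transpose, which leaves scalars alone. So the Pauli matrix has
  to commute with it up to \<open>\<tau> * \<epsilon> a\<close>.\<close>

theorem real_cl_group_iso_pauli_form_group:
  assumes x: "x \<subseteq> {..<K}" "ev \<longrightarrow> even (card x)" and \<tau>: "\<tau> * \<tau> = 1"
    and \<epsilon>: "\<sigma> = cnj \<and> \<epsilon> = \<zeta> \<or> \<sigma> = (\<lambda>z. z) \<and> \<epsilon> = (\<lambda>a. (-1) ^ \<pi> a)"
    and comm: "\<And>a. a < n \<Longrightarrow>
      (-1) ^ (card (jw_flip K (\<pi> a) \<inter> z) + card (x \<inter> jw_phase (\<pi> a))) = \<tau> * \<epsilon> a"
  shows "lie_iso (real_cl_group n \<zeta> \<B> \<tau>) (real_cl_mult n \<zeta>)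
    (form_group I \<sigma> (frestrict I (pauli K x z))) (fmul I)"
proof (rule real_cl_group_iso_form_group)
  let ?P = "pauli K x z" and ?S = "frestrict I (pauli K x z)"
  show \<sigma>: "scalar_conj \<sigma>" using \<epsilon> by (auto simp: scalar_conj_def)
  show "?S \<in> fmats I" "fscale ((-1) ^ card (x \<inter> z)) ?S \<in> fmats I" by simp_all
  have P_I: "?P r t = 0" if "r \<in> J" "r \<notin> I" "t \<in> I" for r t
  proof -
    have "finite t" "finite x" using that(3) x(1) by (auto simp: spin_index_def intro: finite_subset)
    then show ?thesis using that x(2) by (auto simp: pauli_def spin_index_def even_card_symdiff)
  qed
  have "fmul I ?S ?S = frestrict I (fmul J ?P ?P)"
    by (intro frestrict_fmul [symmetric] I_subset J P_I)
  also have "\<dots> = fscale ((-1) ^ card (x \<inter> z)) (fone I)"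
    by (simp add: pauli_mult x frestrict_fscale) (auto simp: fscale_def frestrict_def pauli_def fone_def spin_index_def fun_eq_iff)
  finally have SS: "fmul I ?S ?S = fscale ((-1) ^ card (x \<inter> z)) (fone I)" .
  show "fmul I (fscale ((-1) ^ card (x \<inter> z)) ?S) ?S = fone I"
    by (simp add: fmul_scale_left SS fscale_fscale flip: power_mult_distrib)
  fix A assume A: "A \<in> \<B>"
  then have An: "A \<subseteq> {..<n}" "finite A" by (auto simp: blade_index_def intro: finite_subset)
  let ?b = "blade J gen n A"
  have swap: "fmul J ?P (gen a) = fscale (of_real (\<tau> * \<epsilon> a)) (fmul J (gen a) ?P)" if "a < n" for a
  proof -
    have "(-1) ^ (card (jw_flip K (\<pi> a) \<inter> z) + card (x \<inter> jw_phase (\<pi> a))) = complex_of_real (\<tau> * \<epsilon> a)"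
      using arg_cong [OF comm [OF that], of complex_of_real] by (simp only: of_real_power of_real_minus of_real_1)
    then show ?thesis
      unfolding gen_def jw_def fmul_scale_right fmul_scale_left
      by (subst pauli_commute) (simp_all add: x jw_flip_subset fscale_fscale mult_ac)
  qed
  have star: "fstar \<sigma> (gen a) = fscale (of_real (\<epsilon> a)) (gen a)" if "a < n" for a
  proof -
    have "fstar \<sigma> (gen a) = fscale (\<sigma> (gen_scalar a) * (-1) ^ \<pi> a) (jw K (\<pi> a))"
      using that by (simp add: gen_def fstar_fscale [OF \<sigma>] fstar_jw [OF \<sigma>] \<pi>_le fscale_fscale)
    also have "\<sigma> (gen_scalar a) * (-1) ^ \<pi> a = of_real (\<epsilon> a) * gen_scalar a"
      using \<epsilon> gen_scalar_cnj [OF that] by auto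
    finally show ?thesis by (simp add: gen_def fscale_fscale)
  qed
  have \<tau>A: "\<tau> ^ card A * \<tau> ^ card A = 1" using \<tau> by (simp flip: power_mult_distrib)
  have "fmul J ?P ?b = fscale (\<Prod>a\<in>A. of_real (\<tau> * \<epsilon> a)) (fmul J ?b ?P)"
    by (intro blade_swap J pauli_in x swap An)
  also have "(\<Prod>a\<in>A. of_real (\<tau> * \<epsilon> a)) = complex_of_real (\<tau> ^ card A * prod \<epsilon> A)"
    by (simp add: prod.distrib)
  \<comment> \<open>The anti-involution and the swap each contribute \<open>\<tau> ^ card A\<close>;
    the two cancel and leave the sign of the star on the blade.\<close>
  finally have "fscale (of_real (rev_sign (card A) * \<tau> ^ card A)) (fmul J ?P ?b)
      = fscale (of_real (rev_sign (card A) * prod \<epsilon> A * (\<tau> ^ card A * \<tau> ^ card A))) (fmul J ?b ?P)"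
    by (simp only: fscale_fscale of_real_mult [symmetric] mult_ac)
  also have "\<dots> = fmul J (fstar \<sigma> ?b) ?P"
    unfolding \<tau>A by (simp only: fstar_blade [OF \<sigma> star order_refl An(1)] fmul_scale_left mult_1_right)
  finally have "fscale (of_real (rev_sign (card A) * \<tau> ^ card A)) (frestrict I (fmul J ?P ?b))
      = frestrict I (fmul J (fstar \<sigma> ?b) ?P)"
    by (simp only: frestrict_fscale [symmetric])
  also have "frestrict I (fmul J ?P ?b) = fmul I ?S (D A)"
    unfolding D_def by (intro frestrict_fmul I_subset J blade_preserves_I [OF A])
  also have "frestrict I (fmul J (fstar \<sigma> ?b) ?P) = fmul I (fstar \<sigma> (D A)) ?S"
    unfolding D_def frestrict_fstar [OF \<sigma>, symmetric] by (intro frestrict_fmul I_subset J P_I)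
  finally show "fscale (of_real (rev_sign (card A) * \<tau> ^ card A)) (fmul I ?S (D A)) = fmul I (fstar \<sigma> (D A)) ?S" .
qed

end

subsection \<open>Normal forms of the invariant form\<close>

lemma mat_mult_eq_fmul: "mat_mult m = fmul {..<m}"
  by (simp add: mat_mult_def fmul_def fun_eq_iff)

lemma mats_eq_fmats: "mats m = fmats {..<m}"
  by (auto simp: mats_def fmats_def not_less)

lemma mat_one_eq_fone: "mat_one m = fone {..<m}"
  by (simp add: mat_one_def fone_def)

lemma mat_adjoint_eq_fstar: "mat_adjoint A = fstar cnj A"
  by (simp add: mat_adjoint_def fstar_def)

lemma mat_transpose_eq_fstar: "mat_transpose A = fstar (\<lambda>z. z) A"
  by (simp add: mat_transpose_def fstar_def)

lemmas mat_eq = mat_mult_eq_fmul mats_eq_fmats mat_one_eq_fone mat_adjoint_eq_fstar mat_transpose_eq_fstar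

lemma scalar_conj_cnj [simp]: "scalar_conj cnj" and scalar_conj_id [simp]: "scalar_conj (\<lambda>z. z)"
  by (simp_all add: scalar_conj_def)

lemma U_grp_eq: "U_grp m = form_group {..<m} cnj (fone {..<m})"
  by (auto simp: U_grp_def form_group_def mat_eq fmul_one_right fstar_in)

lemma O_C_eq: "O_C m = form_group {..<m} (\<lambda>z. z) (fone {..<m})"
  by (auto simp: O_C_def form_group_def mat_eq fmul_one_right fstar_in)

lemma U_rs_eq: "U_rs r s = form_group {..<r + s} cnj (eta_rs r s)"
  by (auto simp: U_rs_def form_group_def mat_eq)

lemma Sp_C_eq: "Sp_C m = form_group {..<2 * m} (\<lambda>z. z) (Omega m)"
  by (auto simp: Sp_C_def form_group_def mat_eq)

lemma bij_betw_append:
  fixes r s :: nat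
  assumes "bij_betw f {..<r} A" "bij_betw g {..<s} B" "A \<inter> B = {}"
  shows "bij_betw (\<lambda>i. if i < r then f i else g (i - r)) {..<r + s} (A \<union> B)"
proof -
  let ?h = "\<lambda>i. if i < r then f i else g (i - r)"
  have "bij_betw ?h {..<r} A \<longleftrightarrow> bij_betw f {..<r} A" by (intro bij_betw_cong) simp
  moreover have "bij_betw (\<lambda>i. i - r) {r..<r + s} {..<s}"
    by (rule bij_betw_byWitness [where f' = "\<lambda>i. i + r"]) auto
  from bij_betw_trans [OF this assms(2)] have "bij_betw (\<lambda>i. g (i - r)) {r..<r + s} B" by (simp add: comp_def)
  moreover have "bij_betw ?h {r..<r + s} B \<longleftrightarrow> bij_betw (\<lambda>i. g (i - r)) {r..<r + s} B"
    by (intro bij_betw_cong) simp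
  ultimately have "bij_betw ?h ({..<r} \<union> {r..<r + s}) (A \<union> B)"
    using assms by (intro bij_betw_combine) simp_all
  moreover have "{..<r} \<union> {r..<r + s} = {..<r + s}" by auto
  ultimately show ?thesis by simp
qed

lemma ex_bij_betw_lessThan: "finite A \<Longrightarrow> card A = m \<Longrightarrow> \<exists>h. bij_betw h {..<m} A"
  using ex_bij_betw_nat_finite [of A] by (auto simp: atLeast0LessThan)

lemma form_group_one_iso:
  assumes "finite I" "card I = m" "scalar_conj \<sigma>"
  shows "lie_iso (form_group I \<sigma> (fone I)) (fmul I) (form_group {..<m} \<sigma> (fone {..<m})) (fmul {..<m})"
proof -
  obtain h where h: "bij_betw h {..<m} I" using ex_bij_betw_lessThan assms by blast
  show ?thesis
  proof (rule form_group_reindex [OF h])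
    fix i j assume "i \<in> {..<m}" "j \<in> {..<m}"
    then show "fone {..<m} i j = fone I (h i) (h j)"
      using h by (auto simp: fone_def bij_betw_def inj_on_def)
  qed (use assms in simp_all)
qed

lemma form_group_diagonal_iso:
  assumes I: "finite I" and r: "card {s \<in> I. P s} = r" and r': "card {s \<in> I. \<not> P s} = r'"
    and S: "S = (\<lambda>s t. if s \<in> I \<and> s = t then (if P s then 1 else -1) else 0)"
  shows "lie_iso (form_group I cnj S) (fmul I) (U_rs r r') (mat_mult (r + r'))"
proof -
  obtain f where f: "bij_betw f {..<r} {s \<in> I. P s}"
    using ex_bij_betw_lessThan [OF _ r] I by auto
  obtain g where g: "bij_betw g {..<r'} {s \<in> I. \<not> P s}"
    using ex_bij_betw_lessThan [OF _ r'] I by auto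
  define h where "h = (\<lambda>i. if i < r then f i else g (i - r))"
  have "bij_betw h {..<r + r'} ({s \<in> I. P s} \<union> {s \<in> I. \<not> P s})"
    unfolding h_def by (rule bij_betw_append [OF f g]) auto
  also have "{s \<in> I. P s} \<union> {s \<in> I. \<not> P s} = I" by auto
  finally have h: "bij_betw h {..<r + r'} I" .
  have P: "P (h i) \<longleftrightarrow> i < r" "h i \<in> I" if "i < r + r'" for i
    using bij_betw_apply [OF f, of i] bij_betw_apply [OF g, of "i - r"] that by (auto simp: h_def)
  show ?thesis unfolding U_rs_eq mat_mult_eq_fmul
  proof (rule form_group_reindex [OF h])
    fix i j assume ij: "i \<in> {..<r + r'}" "j \<in> {..<r + r'}"
    then have "h i = h j \<longleftrightarrow> i = j" using h by (auto simp: bij_betw_def inj_on_def)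
    then show "eta_rs r r' i j = S (h i) (h j)" using P ij by (auto simp: eta_rs_def S)
  qed (auto simp: S fmats_def eta_rs_def)
qed

text \<open>Arithmetic in the commutative algebra generated by an involution S, where its square
  root is found.\<close>

lemma fmul_linear_combination:
  assumes I: "finite I" and S: "S \<in> fmats I" "fmul I S S = fone I"
  shows "fmul I (\<lambda>s t. a * fone I s t + b * S s t) (\<lambda>s t. c * fone I s t + d * S s t)
    = (\<lambda>s t. (a * c + b * d) * fone I s t + (a * d + b * c) * S s t)"
proof -
  have add_left: "fmul I (\<lambda>s t. X s t + Y s t) Z = (\<lambda>s t. fmul I X Z s t + fmul I Y Z s t)"
    and add_right: "fmul I Z (\<lambda>s t. X s t + Y s t) = (\<lambda>s t. fmul I Z X s t + fmul I Z Y s t)" for X Y Z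
    by (simp_all add: fmul_def fun_eq_iff algebra_simps sum.distrib)
  have lin: "(\<lambda>s t. a * fone I s t + b * S s t) = (\<lambda>s t. fscale a (fone I) s t + fscale b S s t)" for a b
    by (simp add: fscale_def)
  show ?thesis
    unfolding lin add_left add_right fmul_scale_left fmul_scale_right
    by (simp add: fmul_one_left fmul_one_right I S) (simp add: fscale_def fun_eq_iff algebra_simps)
qed

text \<open>The square root \<open>T\<close> of the symmetric involution \<open>S\<close> with eigenvalues 1 and \<open>\<i>\<close> satisfies \<open>T\<^sup>T T = S\<close>.\<close>
lemma form_group_symmetric_involution_iso:
  assumes I: "finite I" "card I = m" and S: "S \<in> fmats I" "fmul I S S = fone I" "fstar (\<lambda>z. z) S = S"
  shows "lie_iso (form_group I (\<lambda>z. z) S) (fmul I) (O_C m) (mat_mult m)"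
proof -
  \<comment> \<open>This is \<open>(1 + S) / 2 + \<i> * (1 - S) / 2\<close>, in terms of the
    projections to the eigenspaces of S; T' has \<open>- \<i>\<close> instead.\<close>
  define T where "T = (\<lambda>s t. (1 + \<i>) / 2 * fone I s t + (1 - \<i>) / 2 * S s t)"
  define T' where "T' = (\<lambda>s t. (1 - \<i>) / 2 * fone I s t + (1 + \<i>) / 2 * S s t)"
  note mult = fmul_linear_combination [OF I(1) S(1,2)]
  have coeffs: "(1 + \<i>) / 2 * ((1 - \<i>) / 2) + (1 - \<i>) / 2 * ((1 + \<i>) / 2) = 1"
    "(1 - \<i>) / 2 * ((1 + \<i>) / 2) + (1 + \<i>) / 2 * ((1 - \<i>) / 2) = 1"
    "(1 + \<i>) / 2 * ((1 + \<i>) / 2) + (1 - \<i>) / 2 * ((1 - \<i>) / 2) = 0"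
    "(1 - \<i>) / 2 * ((1 - \<i>) / 2) + (1 + \<i>) / 2 * ((1 + \<i>) / 2) = 0"
    by (simp_all add: field_simps)
  have "fmul I T T' = fone I" "fmul I T' T = fone I" "fmul I T T = S"
    unfolding T_def T'_def mult coeffs by simp_all
  moreover have T: "T \<in> fmats I" "T' \<in> fmats I"
    using S(1) by (auto simp: T_def T'_def fmats_def fone_def)
  moreover have "fstar (\<lambda>z. z) T = T"
    using S(3) by (auto simp: T_def fstar_def fone_def fun_eq_iff)
  ultimately have "lie_iso (form_group I (\<lambda>z. z) S) (fmul I) (form_group I (\<lambda>z. z) (fone I)) (fmul I)"
    using I by (intro form_group_conjugate [where T = T and T' = T']) (simp_all add: fmul_one_right)
  then show ?thesis
    unfolding O_C_eq mat_mult_eq_fmul using form_group_one_iso [OF I scalar_conj_id] by (rule lie_iso_trans)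
qed

section \<open>Pauli forms on the spin spaces\<close>

lemma finite_spin_index: "finite (spin_index K ev)"
  by (rule finite_subset [of _ "Pow {..<K}"]) (auto simp: spin_index_def)

lemma spin_index_symdiff:
  assumes "s \<in> spin_index K ev" "x \<subseteq> {..<K}" "ev \<longrightarrow> even (card x)"
  shows "symdiff s x \<in> spin_index K ev"
proof -
  have "finite s" "finite x" using assms by (auto simp: spin_index_def intro: finite_subset)
  then show ?thesis using assms symdiff_subset [of s "{..<K}" x]
    by (auto simp: spin_index_def even_card_symdiff)
qed

text \<open>Flipping the bits in x changes the parity of the intersection with z. This yields
  signature 0 for diagonal forms and the two halves of a symplectic basis.\<close>

lemma card_spin_index_even_Int:
  assumes x: "x \<subseteq> {..<K}" "ev \<longrightarrow> even (card x)" "odd (card (x \<inter> z))"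
  shows "2 * card {s \<in> spin_index K ev. even (card (s \<inter> z))} = card (spin_index K ev)"
proof (rule card_involution_half [where f = "\<lambda>s. symdiff s x"])
  show "finite (spin_index K ev)" by (rule finite_spin_index)
  fix s assume s: "s \<in> spin_index K ev"
  show "symdiff s x \<in> spin_index K ev" using spin_index_symdiff s x by blast
  show "symdiff (symdiff s x) x = s" by (simp add: symdiff_assoc)
  have "symdiff s x \<inter> z = symdiff (s \<inter> z) (x \<inter> z)" by (auto simp: symdiff_def)
  moreover have "finite s" "finite x" using s x by (auto simp: spin_index_def intro: finite_subset)
  ultimately show "even (card (symdiff s x \<inter> z)) \<longleftrightarrow> \<not> even (card (s \<inter> z))"
    using x(3) by (simp add: even_card_symdiff)
qed

text \<open>The form pairs s only with \<open>symdiff s x\<close>, with opposite signs in the two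
  orders. List the s meeting z evenly first, then their partners in the same order: the Gram matrix
  becomes \<open>Omega\<close>.\<close>

lemma form_group_pauli_Sp_iso:
  assumes x: "x \<subseteq> {..<K}" "ev \<longrightarrow> even (card x)" "odd (card (x \<inter> z))"
    and m: "card (spin_index K ev) = 2 * m"
  shows "lie_iso (form_group (spin_index K ev) (\<lambda>z. z) (frestrict (spin_index K ev) (pauli K x z)))
    (fmul (spin_index K ev)) (Sp_C m) (mat_mult (2 * m))"
proof -
  let ?I = "spin_index K ev"
  define A where "A = {s \<in> ?I. even (card (s \<inter> z))}"
  define B where "B = {s \<in> ?I. odd (card (s \<inter> z))}"
  have "card A = m" using card_spin_index_even_Int [OF x] m by (simp add: A_def)
  then obtain f where f: "bij_betw f {..<m} A"
    using ex_bij_betw_lessThan [of A m] finite_spin_index by (auto simp: A_def)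
  have parity: "even (card (symdiff s x \<inter> z)) \<longleftrightarrow> odd (card (s \<inter> z))" if "s \<in> ?I" for s
  proof -
    have "symdiff s x \<inter> z = symdiff (s \<inter> z) (x \<inter> z)" by (auto simp: symdiff_def)
    moreover have "finite s" "finite x" using that x by (auto simp: spin_index_def intro: finite_subset)
    ultimately show ?thesis using x(3) by (simp add: even_card_symdiff)
  qed
  have "bij_betw (\<lambda>s. symdiff s x) A B"
    by (rule bij_betw_byWitness [where f' = "\<lambda>s. symdiff s x"])
      (auto simp: A_def B_def parity symdiff_assoc intro: spin_index_symdiff [OF _ x(1,2)])
  from bij_betw_trans [OF f this] have "bij_betw (\<lambda>i. symdiff (f i) x) {..<m} B"
    by (simp add: comp_def)
  define h where "h = (\<lambda>i. if i < m then f i else symdiff (f (i - m)) x)"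
  have "bij_betw h {..<m + m} (A \<union> B)"
    unfolding h_def by (rule bij_betw_append) (fact | auto simp: A_def B_def)+
  moreover have "A \<union> B = ?I" by (auto simp: A_def B_def)
  ultimately have h: "bij_betw h {..<2 * m} ?I" by (simp add: mult_2)
  have hI: "h i \<in> ?I" if "i < 2 * m" for i using bij_betw_apply [OF h] that by simp
  have inj: "h i = h j \<longleftrightarrow> i = j" if "i < 2 * m" "j < 2 * m" for i j
    using h that by (auto simp: bij_betw_def inj_on_def)
  have flip: "symdiff (h j) x = h (if j < m then j + m else j - m)" if "j < 2 * m" for j
    using that by (auto simp: h_def symdiff_assoc)
  have sgn: "even (card (h j \<inter> z)) \<longleftrightarrow> j < m" if "j < 2 * m" for j
  proof -
    have fA: "f i \<in> A" if "i < m" for i using bij_betw_apply [OF f] that by simp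
    show ?thesis using fA [of j] fA [of "j - m"] that by (auto simp: h_def A_def parity)
  qed
  show ?thesis unfolding Sp_C_eq mat_mult_eq_fmul
  proof (rule form_group_reindex [OF h])
    fix i j assume "i \<in> {..<2 * m}" "j \<in> {..<2 * m}"
    then have ij: "i < 2 * m" "j < 2 * m" by auto
    have "h j \<subseteq> {..<K}" using hI [OF ij(2)] by (simp add: spin_index_def)
    then have "frestrict ?I (pauli K x z) (h i) (h j)
        = (if i = (if j < m then j + m else j - m) then if j < m then 1 else -1 else 0)"
      using hI ij flip [OF ij(2)] inj [of i "if j < m then j + m else j - m"] sgn [OF ij(2)]
      by (auto simp: frestrict_def pauli_def minus_one_power_iff)
    then show "Omega m i j = frestrict ?I (pauli K x z) (h i) (h j)"
      using ij by (auto simp: Omega_def)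
  qed (auto simp: fmats_def frestrict_def Omega_def)
qed

lemma ex_bij_betw_initial_segment:
  assumes "W \<subseteq> {..<n}" "card W = m"
  shows "\<exists>\<pi>. bij_betw \<pi> {..<n} {..<n} \<and> (\<forall>a<n. \<pi> a < m \<longleftrightarrow> a \<in> W)"
proof -
  have fin: "finite W" using assms(1) by (auto intro: finite_subset)
  have le: "m \<le> n" using card_mono [OF _ assms(1)] assms(2) by simp
  have c: "card ({..<n} - W) = n - m" using assms fin by (simp add: card_Diff_subset)
  obtain f where f: "bij_betw f {..<m} W" using ex_bij_betw_lessThan assms(2) fin by blast
  obtain g where g: "bij_betw g {..<n - m} ({..<n} - W)" using ex_bij_betw_lessThan [OF _ c] by blast
  define h where "h = (\<lambda>i. if i < m then f i else g (i - m))"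
  have "bij_betw h {..<m + (n - m)} (W \<union> ({..<n} - W))"
    unfolding h_def by (rule bij_betw_append [OF f g]) auto
  also have "W \<union> ({..<n} - W) = {..<n}" using assms by auto
  finally have h: "bij_betw h {..<n} {..<n}" using le by simp
  have hW: "h i \<in> W \<longleftrightarrow> i < m" if "i < n" for i
    using bij_betw_apply [OF f, of i] bij_betw_apply [OF g, of "i - m"] that le by (auto simp: h_def)
  have "inv_into {..<n} h a < m \<longleftrightarrow> a \<in> W" if "a < n" for a
    using hW [of "inv_into {..<n} h a"] bij_betw_apply [OF bij_betw_inv_into [OF h], of a]
      bij_betw_inv_into_right [OF h, of a] that by simp
  then show ?thesis using bij_betw_inv_into [OF h] by blast
qed

section \<open>Unitary, symplectic and orthogonal types\<close>

lemma jw_clifford_permute: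
  assumes "jw_clifford K ev n \<zeta> \<pi>" "bij_betw \<pi>' {..<n} {..<n}"
  shows "jw_clifford K ev n \<zeta> \<pi>'"
  using assms by (simp add: jw_clifford_def)

text \<open>When every generator squares to \<open>\<tau>\<close>, the anti-involution agrees with
  the adjoint on generators, so the form is the identity.\<close>

theorem (in jw_clifford) real_cl_group_iso_U:
  assumes "\<tau> * \<tau> = 1" "\<And>a. a < n \<Longrightarrow> \<zeta> a = \<tau>"
  shows "lie_iso (real_cl_group n \<zeta> \<B> \<tau>) (real_cl_mult n \<zeta>) (U_grp (card I)) (mat_mult (card I))"
proof -
  have "lie_iso (real_cl_group n \<zeta> \<B> \<tau>) (real_cl_mult n \<zeta>) (form_group I cnj (frestrict I (pauli K {} {}))) (fmul I)"
    by (rule real_cl_group_iso_pauli_form_group [where \<epsilon> = \<zeta>]) (use assms in simp_all)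
  also have "frestrict I (pauli K {} {}) = fone I"
    by (auto simp: frestrict_def pauli_def fone_def spin_index_def fun_eq_iff)
  finally show ?thesis
    unfolding U_grp_eq mat_mult_eq_fmul
    by (rule lie_iso_trans) (rule form_group_one_iso [OF finite_spin_index refl scalar_conj_cnj])
qed

text \<open>The permutation pairs up the generators of square \<open>- \<tau>\<close>, so that the form is diagonal.\<close>
theorem real_cl_group_iso_U_rs:
  assumes jw: "jw_clifford K ev n \<zeta> \<pi>" and \<tau>: "\<tau> * \<tau> = 1"
    and r: "card {a. a < n \<and> \<zeta> a = - \<tau>} = 2 * r" "0 < r" "ev \<longrightarrow> r < K"
    and m: "card (spin_index K ev) = 2 * m"
  shows "lie_iso (real_cl_group n \<zeta> (blade_index n ev) \<tau>) (real_cl_mult n \<zeta>) (U_rs m m) (mat_mult (2 * m))"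
proof -
  let ?W = "{a. a < n \<and> \<zeta> a = - \<tau>}"
  obtain \<pi>' where \<pi>': "bij_betw \<pi>' {..<n} {..<n}" "\<forall>a<n. \<pi>' a < 2 * r \<longleftrightarrow> a \<in> ?W"
    using ex_bij_betw_initial_segment [of ?W n "2 * r"] r by auto
  interpret jw_clifford K ev n \<zeta> \<pi>' using jw_clifford_permute [OF jw \<pi>'(1)] .
  have "2 * r \<le> n" using card_mono [of "{..<n}" ?W] r by auto
  then have rK: "r \<le> K" using n_eq by (simp split: if_splits)
  \<comment> \<open>The matrices with numbers 2j and 2j + 1 flip bit j, so the phases on the first r
    bits anticommute with exactly the first 2r of them.\<close>
  let ?S = "frestrict I (pauli K {} {..<r})"
  have \<zeta>\<tau>: "\<tau> * \<zeta> a = (if \<pi>' a < 2 * r then -1 else 1)" if "a < n" for a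
    using \<pi>'(2) \<zeta>_cases [OF that] that \<tau> square_eq_1_iff [of \<tau>] by auto
  have "lie_iso (real_cl_group n \<zeta> \<B> \<tau>) (real_cl_mult n \<zeta>) (form_group I cnj ?S) (fmul I)" (is ?iso)
  proof (rule real_cl_group_iso_pauli_form_group [where \<epsilon> = \<zeta>])
    fix a assume "a < n"
    have "jw_flip K (\<pi>' a) \<inter> {..<r} = (if \<pi>' a < 2 * r then {\<pi>' a div 2} else {})"
      using rK by (auto simp: jw_flip_def)
    then show "(-1) ^ (card (jw_flip K (\<pi>' a) \<inter> {..<r}) + card ({} \<inter> jw_phase (\<pi>' a))) = \<tau> * \<zeta> a"
      using \<zeta>\<tau> [OF \<open>a < n\<close>] by simp
  qed (use \<tau> in simp_all)
  let ?P = "\<lambda>s. even (card (s \<inter> {..<r}))"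
  \<comment> \<open>A flip meeting the first r bits exactly once. On a half-spin space it must also
    have even size; bit K - 1 is then free because r < K.\<close>
  define x where "x = (if ev then {0, K - 1} else {0})"
  have "x \<inter> {..<r} = {0}" using r by (auto simp: x_def)
  moreover have "x \<subseteq> {..<K}" "ev \<longrightarrow> even (card x)" using r rK by (auto simp: x_def)
  ultimately have "2 * card {s \<in> I. ?P s} = card I"
    by (intro card_spin_index_even_Int [of x]) simp_all
  then have card_P: "card {s \<in> I. ?P s} = m" using m by simp
  have "card {s \<in> I. \<not> ?P s} = card (I - {s \<in> I. ?P s})" by (rule arg_cong [where f = card]) auto
  also have "\<dots> = m" using card_P m finite_spin_index by (subst card_Diff_subset) auto
  finally have "lie_iso (form_group I cnj ?S) (fmul I) (U_rs m m) (mat_mult (m + m))"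
    by (intro form_group_diagonal_iso [OF finite_spin_index card_P])
      (auto simp: frestrict_def pauli_def spin_index_def fun_eq_iff minus_one_power_iff)
  then show ?thesis using lie_iso_trans [OF \<open>?iso\<close>] by (simp add: mult_2)
qed

text \<open>The Pauli matrix of \<open>{..<K}\<close> and this set conjugates every Jordan-Wigner matrix
to its transpose, up to the common sign \<open>(-1) ^ K\<close>.\<close>
definition transpose_phase :: "nat \<Rightarrow> nat set" where
  "transpose_phase K = {j. j < K \<and> odd (K - j)}"

text \<open>This size gives the symmetry sign of the transpose form. The elements are K - 1, K - 3
  and so on, counted from the top.\<close>

lemma card_transpose_phase: "card (transpose_phase K) = (K + 1) div 2"
proof -
  have "bij_betw (\<lambda>j. (K - 1 - j) div 2) (transpose_phase K) {..<(K + 1) div 2}"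
  proof (rule bij_betw_byWitness [where f' = "\<lambda>i. K - 1 - 2 * i"])
    show "\<forall>j\<in>transpose_phase K. K - 1 - 2 * ((K - 1 - j) div 2) = j"
      unfolding transpose_phase_def by auto
    show "\<forall>i\<in>{..<(K + 1) div 2}. (K - 1 - (K - 1 - 2 * i)) div 2 = i" by auto
    show "(\<lambda>j. (K - 1 - j) div 2) ` transpose_phase K \<subseteq> {..<(K + 1) div 2}"
      unfolding transpose_phase_def by clarsimp presburger
    show "(\<lambda>i. K - 1 - 2 * i) ` {..<(K + 1) div 2} \<subseteq> transpose_phase K"
      unfolding transpose_phase_def by clarsimp presburger
  qed
  then show ?thesis by (simp add: bij_betw_same_card)
qed

text \<open>The form flips all K bits, hence preserves the half-spin space when K is even.\<close>

theorem (in jw_clifford) real_cl_group_iso_transpose_form_group: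
  assumes "ev \<longrightarrow> even K"
  shows "lie_iso (real_cl_group n \<zeta> \<B> ((-1) ^ K)) (real_cl_mult n \<zeta>)
    (form_group I (\<lambda>z. z) (frestrict I (pauli K {..<K} (transpose_phase K)))) (fmul I)"
proof (rule real_cl_group_iso_pauli_form_group)
  fix a assume "a < n"
  then have a: "\<pi> a \<le> 2 * K" by (rule \<pi>_le)
  have 1: "card (jw_flip K (\<pi> a) \<inter> transpose_phase K) = (if \<pi> a < 2 * K \<and> odd (K - \<pi> a div 2) then 1 else 0)"
    by (auto simp: jw_flip_def transpose_phase_def)
  have 2: "{..<K} \<inter> jw_phase (\<pi> a) = {..<(\<pi> a + 1) div 2}"
    using a by (auto simp: jw_phase_def)
  \<comment> \<open>With j = \<open>\<pi> a div 2\<close>, the transpose phase contributes K - j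
    modulo 2 and the Jordan-Wigner phase j or j + 1 according to the parity of
    \<open>\<pi> a\<close>.\<close>
  have "even (card (jw_flip K (\<pi> a) \<inter> transpose_phase K) + card ({..<K} \<inter> jw_phase (\<pi> a))) \<longleftrightarrow> even (K + \<pi> a)"
  proof (cases "\<pi> a = 2 * K")
    case False
    then have "\<pi> a < 2 * K" using a by simp
    then show ?thesis unfolding 1 2 card_lessThan by (cases "odd (K - \<pi> a div 2)") (simp_all, presburger+)
  next
    case True
    then show ?thesis unfolding 1 2 by simp
  qed
  then show "(-1) ^ (card (jw_flip K (\<pi> a) \<inter> transpose_phase K) + card ({..<K} \<inter> jw_phase (\<pi> a))) = (-1 :: real) ^ K * (-1) ^ \<pi> a"
    unfolding power_add [symmetric] by (simp only: minus_one_power_iff)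
qed (use assms in \<open>simp_all flip: power_mult_distrib\<close>)

theorem (in jw_clifford) real_cl_group_iso_Sp:
  assumes "ev \<longrightarrow> even K" "odd ((K + 1) div 2)" "card I = 2 * m"
  shows "lie_iso (real_cl_group n \<zeta> \<B> ((-1) ^ K)) (real_cl_mult n \<zeta>) (Sp_C m) (mat_mult (2 * m))"
proof -
  have "{..<K} \<inter> transpose_phase K = transpose_phase K" by (auto simp: transpose_phase_def)
  then show ?thesis
    using assms by (intro lie_iso_trans [OF real_cl_group_iso_transpose_form_group] form_group_pauli_Sp_iso)
      (simp_all add: card_transpose_phase)
qed

text \<open>One sign is both the symmetry and the square of the Pauli form, so a symmetric form is
  also an involution and has the required square root.\<close>

theorem (in jw_clifford) real_cl_group_iso_O:
  assumes "ev \<longrightarrow> even K" "even ((K + 1) div 2)"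
  shows "lie_iso (real_cl_group n \<zeta> \<B> ((-1) ^ K)) (real_cl_mult n \<zeta>) (O_C (card I)) (mat_mult (card I))"
proof (rule lie_iso_trans [OF real_cl_group_iso_transpose_form_group form_group_symmetric_involution_iso])
  let ?P = "pauli K {..<K} (transpose_phase K)"
  have "{..<K} \<inter> transpose_phase K = transpose_phase K" by (auto simp: transpose_phase_def)
  then have one: "(-1) ^ card ({..<K} \<inter> transpose_phase K) = (1 :: complex)"
    using assms by (simp add: card_transpose_phase)
  show "fstar (\<lambda>z. z) (frestrict I ?P) = frestrict I ?P"
    by (simp add: frestrict_fstar [symmetric] fstar_pauli one)
  have "?P r t = 0" if "r \<in> J" "r \<notin> I" "t \<in> I" for r t
    using spin_index_symdiff [of t K ev "{..<K}"] assms that by (auto simp: pauli_def)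
  then have "fmul I (frestrict I ?P) (frestrict I ?P) = frestrict I (fmul J ?P ?P)"
    by (intro frestrict_fmul [symmetric] I_subset J)
  also have "\<dots> = fone I"
    by (simp add: pauli_mult one) (auto simp: frestrict_def pauli_def fone_def spin_index_def fun_eq_iff)
  finally show "fmul I (frestrict I ?P) (frestrict I ?P) = fone I" .
qed (use assms finite_spin_index in simp_all)

subsection \<open>The groups in the Clifford algebra\<close>

text \<open>\<open>\<kappa> = \<i>\<close> covers the subspace of real combinations of the blades in the generators \<open>\<i> e\<^sup>a\<close>,
which square to \<open>- \<eta>\<close>.\<close>
definition clif_group :: "nat \<Rightarrow> nat \<Rightarrow> complex \<Rightarrow> nat set set \<Rightarrow> real \<Rightarrow> clif set" where
  "clif_group p q \<kappa> \<B> \<tau> = {U. (\<forall>A. A \<notin> \<B> \<longrightarrow> U A = 0) \<and> (\<forall>A. U A * cnj \<kappa> ^ card A \<in> \<real>) \<and>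
      cl_mult p q (\<lambda>A. of_real (rev_sign (card A) * \<tau> ^ card A) * U A) U = cl_one}"

definition scaled_sq :: "nat \<Rightarrow> complex \<Rightarrow> nat \<Rightarrow> real" where
  "scaled_sq p \<kappa> a = Re (\<kappa>\<^sup>2) * (if a < p then 1 else -1)"

text \<open>Rescaling the generators by \<open>\<kappa>\<close> multiplies each common square by
  \<open>\<kappa>\<^sup>2\<close>, matching the loss of \<open>2 * card (A \<inter> B)\<close>
  factors in the symmetric difference.\<close>

lemma blade_sign_scaled:
  assumes \<kappa>: "\<kappa> = 1 \<or> \<kappa> = \<i>" and A: "finite A" "finite B"
  shows "\<kappa> ^ card A * \<kappa> ^ card B * blade_sign p A B = of_real (cl_sign (scaled_sq p \<kappa>) A B) * \<kappa> ^ card (symdiff A B)"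
proof -
  have "complex_of_real (scaled_sq p \<kappa> a) = \<kappa>\<^sup>2 * eta_sq p a" for a
    using \<kappa> by (auto simp: scaled_sq_def eta_sq_def)
  then have "complex_of_real (\<Prod>a\<in>A \<inter> B. scaled_sq p \<kappa> a) = \<kappa> ^ (2 * card (A \<inter> B)) * (\<Prod>a\<in>A \<inter> B. eta_sq p a)"
    by (simp add: prod.distrib power_mult)
  moreover have "\<kappa> ^ card A * \<kappa> ^ card B = \<kappa> ^ card (symdiff A B) * \<kappa> ^ (2 * card (A \<inter> B))"
    using card_symdiff [OF A] by (simp flip: power_add)
  ultimately show ?thesis by (simp add: blade_sign_def cl_sign_def)
qed

lemma clif_group_iso_real_cl_group:
  assumes \<kappa>: "\<kappa> = 1 \<or> \<kappa> = \<i>"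
  shows "lie_iso (clif_group p q \<kappa> \<B> \<tau>) (cl_mult p q)
    (real_cl_group (p + q) (scaled_sq p \<kappa>) \<B> \<tau>) (real_cl_mult (p + q) (scaled_sq p \<kappa>))"
proof -
  let ?\<zeta> = "scaled_sq p \<kappa>"
  \<comment> \<open>Coordinates are changed to the blades in the generators
    \<open>\<kappa> e\<^sup>a\<close>, with \<open>cnj \<kappa>\<close> as inverse of
    \<open>\<kappa>\<close>. On the group the real part in \<open>dn\<close> loses nothing.\<close>
  define up where "up u = (\<lambda>A. complex_of_real (u A) * \<kappa> ^ card A)" for u :: "nat set \<Rightarrow> real"
  define dn where "dn U = (\<lambda>A. Re (U A * cnj \<kappa> ^ card A))" for U :: clif
  have \<kappa>1: "\<kappa> ^ m * cnj \<kappa> ^ m = 1" for m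
    using \<kappa> by (auto simp flip: power_mult_distrib)
  have du: "dn (up u) = u" for u
    by (simp add: up_def dn_def mult.assoc \<kappa>1)
  have ud: "up (dn U) = U" if "\<And>A. U A * cnj \<kappa> ^ card A \<in> \<real>" for U
  proof
    fix A
    have "of_real (Re (U A * cnj \<kappa> ^ card A)) = U A * cnj \<kappa> ^ card A"
      by (rule of_real_Re [OF that])
    then have "up (dn U) A = U A * (\<kappa> ^ card A * cnj \<kappa> ^ card A)" by (simp add: up_def dn_def mult_ac)
    then show "up (dn U) A = U A" by (simp add: \<kappa>1)
  qed
  have um: "cl_mult p q (up u) (up v) = up (real_cl_mult (p + q) ?\<zeta> u v)" for u v
  proof
    fix C
    show "cl_mult p q (up u) (up v) C = up (real_cl_mult (p + q) ?\<zeta> u v) C"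
    proof (cases "C \<subseteq> {..<p + q}")
      case True
      then have C: "finite C" by (auto intro: finite_subset)
      have "up u A * up v (symdiff A C) * blade_sign p A (symdiff A C)
          = of_real (u A * v (symdiff A C) * cl_sign ?\<zeta> A (symdiff A C)) * \<kappa> ^ card C" if "A \<subseteq> {..<p + q}" for A
      proof -
        have "finite A" using that by (auto intro: finite_subset)
        moreover from this have "finite (symdiff A C)" using C by (simp add: symdiff_def)
        ultimately have "\<kappa> ^ card A * \<kappa> ^ card (symdiff A C) * blade_sign p A (symdiff A C)
            = of_real (cl_sign ?\<zeta> A (symdiff A C)) * \<kappa> ^ card C"
          using blade_sign_scaled [OF \<kappa>, of A "symdiff A C" p] by simp
        then have "of_real (u A * v (symdiff A C)) * (\<kappa> ^ card A * \<kappa> ^ card (symdiff A C) * blade_sign p A (symdiff A C))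
            = of_real (u A * v (symdiff A C)) * (of_real (cl_sign ?\<zeta> A (symdiff A C)) * \<kappa> ^ card C)"
          by (rule arg_cong)
        then show ?thesis by (simp add: up_def mult_ac)
      qed
      moreover have "up w C = of_real (w C) * \<kappa> ^ card C" for w by (simp add: up_def)
      ultimately show ?thesis using True
        by (simp add: cl_mult_def real_cl_mult_def sum_distrib_right)
    qed (simp add: cl_mult_def up_def real_cl_mult_def)
  qed
  have ui: "up (real_cl_inv \<tau> u) = (\<lambda>A. of_real (rev_sign (card A) * \<tau> ^ card A) * up u A)" for u
    by (simp add: up_def real_cl_inv_def mult_ac)
  have one: "up (\<lambda>A. if A = {} then 1 else 0) = cl_one"
    by (auto simp: up_def cl_one_def)
  have eq: "cl_mult p q (\<lambda>A. of_real (rev_sign (card A) * \<tau> ^ card A) * up u A) (up u) = cl_one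
      \<longleftrightarrow> real_cl_mult (p + q) ?\<zeta> (real_cl_inv \<tau> u) u = (\<lambda>A. if A = {} then 1 else 0)" for u
    unfolding ui [symmetric] um one [symmetric] by (metis du)
  show ?thesis
  proof (rule lie_isoI [where f = dn and g = up])
    show up_in: "up u \<in> clif_group p q \<kappa> \<B> \<tau>" if "u \<in> real_cl_group (p + q) ?\<zeta> \<B> \<tau>" for u
    proof -
      have "up u A * cnj \<kappa> ^ card A \<in> \<real>" for A by (simp add: up_def mult.assoc \<kappa>1)
      moreover have "up u A = 0" if "u A = 0" for A using that by (simp add: up_def)
      ultimately show ?thesis using that unfolding clif_group_def real_cl_group_def mem_Collect_eq eq by (intro conjI allI impI) simp_all
    qed
    show ud': "up (dn U) = U" if "U \<in> clif_group p q \<kappa> \<B> \<tau>" for U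
      using that by (intro ud) (simp add: clif_group_def)
    show "dn U \<in> real_cl_group (p + q) ?\<zeta> \<B> \<tau>" if "U \<in> clif_group p q \<kappa> \<B> \<tau>" for U
      using eq [of "dn U"] that by (simp add: ud' clif_group_def real_cl_group_def) (simp add: dn_def)
    show "dn (cl_mult p q U V) = real_cl_mult (p + q) ?\<zeta> (dn U) (dn V)"
      if "U \<in> clif_group p q \<kappa> \<B> \<tau>" "V \<in> clif_group p q \<kappa> \<B> \<tau>" for U V
      using um [of "dn U" "dn V"] that by (simp add: ud' du)
    show "dn (up u) = u" for u by (rule du)
    show "continuous_on (clif_group p q \<kappa> \<B> \<tau>) dn"
      unfolding dn_def by (intro continuous_on_coordinatewise_then_product continuous_intros continuous_on_coord)
    show "continuous_on (real_cl_group (p + q) ?\<zeta> \<B> \<tau>) up"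
      unfolding up_def by (intro continuous_on_coordinatewise_then_product continuous_intros continuous_on_coord)
  qed
qed

lemma cl_carrier_iff: "U \<in> cl_carrier n \<longleftrightarrow> (\<forall>A. A \<notin> blade_index n False \<longrightarrow> U A = 0)"
  by (auto simp: cl_carrier_def blade_index_def)

lemma cl_rev_eq: "cl_rev U = (\<lambda>A. of_real (rev_sign (card A)) * U A)"
  by (simp add: cl_rev_def rev_sign_def)

lemma G23_eq: "G23 p q = clif_group p q 1 (blade_index (p + q) False) 1"
  by (auto simp: G23_def cl_real_def clif_group_def cl_carrier_iff cl_rev_eq)

lemma G12_eq: "G12 p q = clif_group p q 1 (blade_index (p + q) False) (-1)"
  by (auto simp: G12_def cl_real_def clif_group_def cl_carrier_iff cl_rev_eq cl_hat_def mult.assoc)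

text \<open>On even blades \<open>\<tau>\<close> has no effect. The choice -1 serves the negative
  definite signature, where all generators square to -1.\<close>

lemma G2_eq:
  assumes "\<tau> = 1 \<or> \<tau> = -1"
  shows "G2 p q = clif_group p q 1 (blade_index (p + q) True) \<tau>"
proof -
  have supp: "U \<in> cl_even p q \<longleftrightarrow> (\<forall>A. A \<notin> blade_index (p + q) True \<longrightarrow> U A = 0) \<and> (\<forall>A. U A \<in> \<real>)" for U
    by (auto simp: cl_even_def cl_real_def cl_carrier_def blade_index_def)
  have "cl_rev U = (\<lambda>A. of_real (rev_sign (card A) * \<tau> ^ card A) * U A)" if "U \<in> cl_even p q" for U
  proof
    fix A
    show "cl_rev U A = of_real (rev_sign (card A) * \<tau> ^ card A) * U A"
      using that assms by (cases "even (card A)") (auto simp: cl_even_def cl_rev_eq)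
  qed
  then show ?thesis by (auto simp: G2_def clif_group_def supp)
qed

lemma cl_even_i_odd_iff:
  "U \<in> cl_even_i_odd p q \<longleftrightarrow> (\<forall>A. A \<notin> blade_index (p + q) False \<longrightarrow> U A = 0) \<and> (\<forall>A. U A * cnj \<i> ^ card A \<in> \<real>)"
proof -
  have "z * cnj \<i> ^ m \<in> \<real> \<longleftrightarrow> (even m \<longrightarrow> z \<in> \<real>) \<and> (odd m \<longrightarrow> Re z = 0)" for z m
  proof (cases "even m")
    case True
    then obtain k where "m = 2 * k" by blast
    then show ?thesis by (cases "even k") (simp_all add: power_mult complex_is_Real_iff)
  next
    case False
    then obtain k where "m = 2 * k + 1" using oddE by blast
    then show ?thesis by (cases "even k") (simp_all add: power_mult power_add complex_is_Real_iff)
  qed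
  then show ?thesis by (auto simp: cl_even_i_odd_def cl_carrier_iff)
qed

text \<open>Even coordinates are real and odd ones imaginary, so conjugation acts as the grade
  involution. It therefore gives \<open>\<tau> = -1\<close> for \<open>cl_dagger\<close> alone and
  \<open>\<tau> = 1\<close> after a further \<open>cl_hat\<close>.\<close>

lemma cl_cnj_even_i_odd:
  assumes "U \<in> cl_even_i_odd p q"
  shows "cl_cnj U = (\<lambda>A. (-1) ^ card A * U A)"
proof
  fix A
  show "cl_cnj U A = (-1) ^ card A * U A"
    using assms by (cases "even (card A)")
      (auto simp: cl_even_i_odd_def cl_cnj_def complex_eq_iff complex_is_Real_iff)
qed

lemma G2i1_eq: "G2i1 p q = clif_group p q \<i> (blade_index (p + q) False) (-1)"
proof -
  have "cl_dagger U = (\<lambda>A. of_real (rev_sign (card A) * (-1) ^ card A) * U A)" if "U \<in> cl_even_i_odd p q" for U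
    using cl_cnj_even_i_odd [OF that] by (simp add: cl_dagger_def cl_rev_eq mult.assoc)
  then show ?thesis by (auto simp: G2i1_def clif_group_def cl_even_i_odd_iff)
qed

lemma G2i3_eq: "G2i3 p q = clif_group p q \<i> (blade_index (p + q) False) 1"
proof -
  have "cl_dagger (cl_hat U) = (\<lambda>A. of_real (rev_sign (card A) * 1 ^ card A) * U A)" if "U \<in> cl_even_i_odd p q" for U
  proof
    fix A
    have "(-1) ^ card A * ((-1) ^ card A * U A) = U A" by (simp flip: mult.assoc power_mult_distrib)
    then show "cl_dagger (cl_hat U) A = of_real (rev_sign (card A) * 1 ^ card A) * U A"
      using fun_cong [OF cl_cnj_even_i_odd [OF that], of A]
      by (simp add: cl_dagger_def cl_rev_eq cl_cnj_def cl_hat_def)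
  qed
  then show ?thesis by (auto simp: G2i3_def clif_group_def cl_even_i_odd_iff)
qed

section \<open>Signatures, dimensions and residues\<close>

lemma card_scaled_sq:
  assumes "\<kappa> = 1 \<and> P = p \<and> Q = q \<or> \<kappa> = \<i> \<and> P = q \<and> Q = p"
  shows "card {a. a < p + q \<and> scaled_sq p \<kappa> a = -1} = Q" "card {a. a < p + q \<and> scaled_sq p \<kappa> a = 1} = P"
proof -
  have "{a. a < p + q \<and> scaled_sq p 1 a = -1} = {p..<p + q}" "{a. a < p + q \<and> scaled_sq p \<i> a = -1} = {..<p}"
    "{a. a < p + q \<and> scaled_sq p 1 a = 1} = {..<p}" "{a. a < p + q \<and> scaled_sq p \<i> a = 1} = {p..<p + q}"
    by (auto simp: scaled_sq_def split: if_splits)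
  with assms show "card {a. a < p + q \<and> scaled_sq p \<kappa> a = -1} = Q" "card {a. a < p + q \<and> scaled_sq p \<kappa> a = 1} = P"
    by (elim disjE conjE; simp)+
qed

lemma jw_clifford_scaled_sq:
  assumes "\<kappa> = 1 \<and> P = p \<and> Q = q \<or> \<kappa> = \<i> \<and> P = q \<and> Q = p"
    and "p + q = (if ev then 2 * K else 2 * K + 1)" "p + q > 0" "odd (K + Q)"
  shows "jw_clifford K ev (p + q) (scaled_sq p \<kappa>) (\<lambda>a. a)"
proof
  show "scaled_sq p \<kappa> a = 1 \<or> scaled_sq p \<kappa> a = -1" for a using assms(1) by (auto simp: scaled_sq_def)
  show "bij_betw (\<lambda>a. a) {..<p + q} {..<p + q}" by (simp add: bij_betw_def)
  show "odd (K + card {a. a < p + q \<and> scaled_sq p \<kappa> a = -1})"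
    using assms(4) card_scaled_sq(1) [OF assms(1)] by simp
qed (use assms in simp_all)

text \<open>P and Q count the rescaled generators of square 1 and -1, so
  \<open>\<kappa> = \<i>\<close> swaps p and q. N counts those whose square differs from
  \<open>\<tau>\<close>, and \<open>2 ^ d\<close> is the dimension of the spin space.\<close>

theorem clif_group_iso:
  fixes K :: nat
  assumes \<kappa>: "\<kappa> = 1 \<and> P = p \<and> Q = q \<or> \<kappa> = \<i> \<and> P = q \<and> Q = p"
    and \<tau>: "\<tau> = 1 \<and> N = Q \<or> \<tau> = -1 \<and> N = P"
    and n: "p + q = (if ev then 2 * K else 2 * K + 1)" "p + q > 0" and odd: "odd (K + Q)"
    and d: "d = (if ev then K - 1 else K)"
  defines "G \<equiv> clif_group p q \<kappa> (blade_index (p + q) ev) \<tau>"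
  shows "N = 0 \<Longrightarrow> lie_iso G (cl_mult p q) (U_grp (2 ^ d)) (mat_mult (2 ^ d))"
    and "N > 0 \<Longrightarrow> even N \<Longrightarrow> N < p + q \<Longrightarrow>
      lie_iso G (cl_mult p q) (U_rs (2 ^ (d - 1)) (2 ^ (d - 1))) (mat_mult (2 * 2 ^ (d - 1)))"
    and "\<tau> = (-1) ^ K \<Longrightarrow> ev \<longrightarrow> even K \<Longrightarrow> odd ((K + 1) div 2) \<Longrightarrow>
      lie_iso G (cl_mult p q) (Sp_C (2 ^ (d - 1))) (mat_mult (2 * 2 ^ (d - 1)))"
    and "\<tau> = (-1) ^ K \<Longrightarrow> ev \<longrightarrow> even K \<Longrightarrow> even ((K + 1) div 2) \<Longrightarrow>
      lie_iso G (cl_mult p q) (O_C (2 ^ d)) (mat_mult (2 ^ d))"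
proof -
  let ?\<zeta> = "scaled_sq p \<kappa>"
  note jw = jw_clifford_scaled_sq [OF \<kappa> n odd]
  interpret jw_clifford K ev "p + q" ?\<zeta> "\<lambda>a. a" by (rule jw)
  have "\<kappa> = 1 \<or> \<kappa> = \<i>" using \<kappa> by auto
  note iso = lie_iso_trans [OF clif_group_iso_real_cl_group [OF this], of p q \<B> \<tau>, folded G_def]
  have cardI: "card I = 2 ^ d" by (simp add: card_I d)
  have half: "card I = 2 * 2 ^ (d - 1)" if "d > 0"
    unfolding cardI using that by (cases d) simp_all
  have \<tau>2: "\<tau> * \<tau> = 1" using \<tau> by auto
  have N: "card {a. a < p + q \<and> ?\<zeta> a = - \<tau>} = N"
    using \<tau> card_scaled_sq [OF \<kappa>] by auto
  show "lie_iso G (cl_mult p q) (U_grp (2 ^ d)) (mat_mult (2 ^ d))" if "N = 0"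
  proof -
    have "{a. a < p + q \<and> ?\<zeta> a = - \<tau>} = {}" using N that by simp
    then have "?\<zeta> a = \<tau>" if "a < p + q" for a using \<zeta>_cases [OF that] \<tau> that by auto
    from real_cl_group_iso_U [OF \<tau>2 this] show ?thesis unfolding cardI by (rule iso)
  qed
  show "lie_iso G (cl_mult p q) (U_rs (2 ^ (d - 1)) (2 ^ (d - 1))) (mat_mult (2 * 2 ^ (d - 1)))"
    if N': "N > 0" "even N" "N < p + q"
  proof -
    obtain r where r: "N = 2 * r" using N'(2) by blast
    \<comment> \<open>In the even case N < p + q = 2K is what leaves a bit outside the first
      r.\<close>
    then have "0 < r" "ev \<longrightarrow> r < K" "d > 0" using N' n(1) d by (auto split: if_splits)
    with real_cl_group_iso_U_rs [OF jw \<tau>2 _ _ _ half, of r] show ?thesis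
      using N r by (intro iso) simp
  qed
  show "lie_iso G (cl_mult p q) (Sp_C (2 ^ (d - 1))) (mat_mult (2 * 2 ^ (d - 1)))"
    if "\<tau> = (-1) ^ K" "ev \<longrightarrow> even K" "odd ((K + 1) div 2)"
  proof -
    \<comment> \<open>The exponent d - 1 must not be truncated: the parity of
      \<open>(K + 1) div 2\<close> excludes K = 0, and evenness of K excludes K = 1 on a half-spin
      space.\<close>
    have "K > 0" using that(3) by (cases K) auto
    moreover have "K \<noteq> 1" if ev using that \<open>ev \<longrightarrow> even K\<close> by auto
    ultimately have "d > 0" by (auto simp: d)
    from real_cl_group_iso_Sp [OF that(2,3) half [OF this]] show ?thesis
      unfolding that(1) [symmetric] by (rule iso)
  qed
  show "lie_iso G (cl_mult p q) (O_C (2 ^ d)) (mat_mult (2 ^ d))"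
    if "\<tau> = (-1) ^ K" "ev \<longrightarrow> even K" "even ((K + 1) div 2)"
    using real_cl_group_iso_O [OF that(2,3)] unfolding cardI that(1) [symmetric] by (rule iso)
qed

theorem theorem2:
  fixes p q n :: nat
  assumes hn: "n = p + q" and n1: "1 \<le> n"
  shows
  "((int p - int q) mod 8 \<in> {3, 7} \<longrightarrow>
      ((p, q) = (n, 0) \<longrightarrow> lie_iso (G23 p q) (cl_mult p q) (U_grp (2 ^ ((n - 1) div 2))) (mat_mult (2 ^ ((n - 1) div 2))))
    \<and> (n mod 8 \<in> {3, 7} \<and> q \<noteq> 0 \<longrightarrow> lie_iso (G23 p q) (cl_mult p q) (U_rs (2 ^ ((n - 3) div 2)) (2 ^ ((n - 3) div 2))) (mat_mult (2 * 2 ^ ((n - 3) div 2))))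
    \<and> (n mod 8 = 5 \<longrightarrow> lie_iso (G23 p q) (cl_mult p q) (Sp_C (2 ^ ((n - 3) div 2))) (mat_mult (2 * 2 ^ ((n - 3) div 2))))
    \<and> (n mod 8 = 1 \<longrightarrow> lie_iso (G23 p q) (cl_mult p q) (O_C (2 ^ ((n - 1) div 2))) (mat_mult (2 ^ ((n - 1) div 2)))))
  \<and> ((int p - int q) mod 8 \<in> {3, 7} \<longrightarrow>
      ((p, q) = (0, n) \<longrightarrow> lie_iso (G12 p q) (cl_mult p q) (U_grp (2 ^ ((n - 1) div 2))) (mat_mult (2 ^ ((n - 1) div 2))))
    \<and> (n mod 8 \<in> {1, 5} \<and> p \<noteq> 0 \<longrightarrow> lie_iso (G12 p q) (cl_mult p q) (U_rs (2 ^ ((n - 3) div 2)) (2 ^ ((n - 3) div 2))) (mat_mult (2 * 2 ^ ((n - 3) div 2))))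
    \<and> (n mod 8 = 3 \<longrightarrow> lie_iso (G12 p q) (cl_mult p q) (Sp_C (2 ^ ((n - 3) div 2))) (mat_mult (2 * 2 ^ ((n - 3) div 2))))
    \<and> (n mod 8 = 7 \<longrightarrow> lie_iso (G12 p q) (cl_mult p q) (O_C (2 ^ ((n - 1) div 2))) (mat_mult (2 ^ ((n - 1) div 2)))))
  \<and> ((int p - int q) mod 8 \<in> {1, 5} \<longrightarrow>
      ((p, q) = (n, 0) \<longrightarrow> lie_iso (G2i1 p q) (cl_mult p q) (U_grp (2 ^ ((n - 1) div 2))) (mat_mult (2 ^ ((n - 1) div 2))))
    \<and> (n mod 8 \<in> {1, 5} \<and> q \<noteq> 0 \<longrightarrow> lie_iso (G2i1 p q) (cl_mult p q) (U_rs (2 ^ ((n - 3) div 2)) (2 ^ ((n - 3) div 2))) (mat_mult (2 * 2 ^ ((n - 3) div 2))))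
    \<and> (n mod 8 = 3 \<longrightarrow> lie_iso (G2i1 p q) (cl_mult p q) (Sp_C (2 ^ ((n - 3) div 2))) (mat_mult (2 * 2 ^ ((n - 3) div 2))))
    \<and> (n mod 8 = 7 \<longrightarrow> lie_iso (G2i1 p q) (cl_mult p q) (O_C (2 ^ ((n - 1) div 2))) (mat_mult (2 ^ ((n - 1) div 2)))))
  \<and> ((int p - int q) mod 8 \<in> {1, 5} \<longrightarrow>
      ((p, q) = (0, n) \<longrightarrow> lie_iso (G2i3 p q) (cl_mult p q) (U_grp (2 ^ ((n - 1) div 2))) (mat_mult (2 ^ ((n - 1) div 2))))
    \<and> (n mod 8 \<in> {3, 7} \<and> p \<noteq> 0 \<longrightarrow> lie_iso (G2i3 p q) (cl_mult p q) (U_rs (2 ^ ((n - 3) div 2)) (2 ^ ((n - 3) div 2))) (mat_mult (2 * 2 ^ ((n - 3) div 2))))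
    \<and> (n mod 8 = 5 \<longrightarrow> lie_iso (G2i3 p q) (cl_mult p q) (Sp_C (2 ^ ((n - 3) div 2))) (mat_mult (2 * 2 ^ ((n - 3) div 2))))
    \<and> (n mod 8 = 1 \<longrightarrow> lie_iso (G2i3 p q) (cl_mult p q) (O_C (2 ^ ((n - 1) div 2))) (mat_mult (2 ^ ((n - 1) div 2)))))
  \<and> ((int p - int q) mod 8 \<in> {2, 6} \<longrightarrow>
      ((p, q) = (n, 0) \<or> (p, q) = (0, n) \<longrightarrow> lie_iso (G2 p q) (cl_mult p q) (U_grp (2 ^ ((n - 2) div 2))) (mat_mult (2 ^ ((n - 2) div 2))))
    \<and> (n mod 8 \<in> {2, 6} \<and> p \<noteq> 0 \<and> q \<noteq> 0 \<longrightarrow> lie_iso (G2 p q) (cl_mult p q) (U_rs (2 ^ ((n - 4) div 2)) (2 ^ ((n - 4) div 2))) (mat_mult (2 * 2 ^ ((n - 4) div 2))))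
    \<and> (n mod 8 = 4 \<longrightarrow> lie_iso (G2 p q) (cl_mult p q) (Sp_C (2 ^ ((n - 4) div 2))) (mat_mult (2 * 2 ^ ((n - 4) div 2))))
    \<and> (n mod 8 = 0 \<longrightarrow> lie_iso (G2 p q) (cl_mult p q) (O_C (2 ^ ((n - 2) div 2))) (mat_mult (2 ^ ((n - 2) div 2)))))"
proof -
  \<comment> \<open>Only p - q modulo 4 matters: p - q = 2 (K - q) + 1 is 3 modulo 4 exactly when K
    + q is odd.\<close>
  have odd_n: "\<exists>K. n = 2 * K + 1 \<and> odd (K + q)" if "(int p - int q) mod 8 \<in> {3, 7}"
  proof -
    have "(int p - int q) mod 4 = 3" using that mod_mod_cancel [of 4 8 "int p - int q"] by auto
    then show ?thesis using hn by presburger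
  qed
  \<comment> \<open>Here the rescaling by \<open>\<i>\<close> makes p the number of negative
    squares.\<close>
  have odd_n': "\<exists>K. n = 2 * K + 1 \<and> odd (K + p)" if "(int p - int q) mod 8 \<in> {1, 5}"
  proof -
    have "(int p - int q) mod 4 = 1" using that mod_mod_cancel [of 4 8 "int p - int q"] by auto
    then show ?thesis using hn by presburger
  qed
  have even_n: "\<exists>K. n = 2 * K \<and> odd (K + q)" if "(int p - int q) mod 8 \<in> {2, 6}"
  proof -
    have "(int p - int q) mod 4 = 2" using that mod_mod_cancel [of 4 8 "int p - int q"] by auto
    then show ?thesis using hn by presburger
  qed
  have half: "(n - 1) div 2 = K" "(n - 3) div 2 = K - 1" if "n = 2 * K + 1" for K
    using that by auto
  \<comment> \<open>For n = 2 the second equation holds with both sides truncated to 0.\<close>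
  have half': "(n - 2) div 2 = K - 1" "(n - 4) div 2 = K - 1 - 1" if "n = 2 * K" for K
    using that by auto
  have pos: "p + q > 0" using hn n1 by linarith
  show ?thesis (is "(?i \<longrightarrow> ?A) \<and> (?i \<longrightarrow> ?B) \<and> (?ii \<longrightarrow> ?C) \<and> (?ii \<longrightarrow> ?D) \<and> (?iii \<longrightarrow> ?E)")
  proof (intro conjI [of "?i \<longrightarrow> ?A"] conjI [of "?i \<longrightarrow> ?B"] conjI [of "?ii \<longrightarrow> ?C"] conjI [of "?ii \<longrightarrow> ?D"] impI)
    assume ?i
    then obtain K where K: "n = 2 * K + 1" "odd (K + q)" using odd_n by blast
    have n: "p + q = (if False then 2 * K else 2 * K + 1)" and d: "K = (if False then K - 1 else K)"
      using K hn by simp_all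
    note iso = clif_group_iso [where P = p and Q = q, OF _ _ n pos K(2) d]
    show ?A unfolding G23_eq half [OF K(1)]
    proof (intro conjI impI, goal_cases)
      case 1
      then show ?case by (intro iso(1) [where N = q]) simp_all
    next
      case 2
      then have "odd K" using K(1) by (auto; presburger)
      \<comment> \<open>As n is odd, an even q cannot be all of n.\<close>
      then have "even q" "q < p + q" using K hn by presburger+
      with 2 show ?case by (intro iso(2) [where N = q]) simp_all
    next
      case 3
      then have "K mod 4 = 2" using K(1) by presburger
      then have "even K" "odd ((K + 1) div 2)" by presburger+
      then show ?case by (intro iso(3) [where N = q]) simp_all
    next
      case 4
      then have "K mod 4 = 0" using K(1) by presburger
      then have "even K" "even ((K + 1) div 2)" by presburger+
      then show ?case by (intro iso(4) [where N = q]) simp_all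
    qed
    show ?B unfolding G12_eq half [OF K(1)]
    proof (intro conjI impI, goal_cases)
      case 1
      then show ?case by (intro iso(1) [where N = p]) simp_all
    next
      case 2
      then have "even K" using K(1) by (auto; presburger)
      then have "even p" "p < p + q" using K hn by presburger+
      with 2 show ?case by (intro iso(2) [where N = p]) simp_all
    next
      case 3
      then have "K mod 4 = 1" using K(1) by presburger
      then have "odd K" "odd ((K + 1) div 2)" by presburger+
      then show ?case by (intro iso(3) [where N = p]) simp_all
    next
      case 4
      then have "K mod 4 = 3" using K(1) by presburger
      then have "odd K" "even ((K + 1) div 2)" by presburger+
      then show ?case by (intro iso(4) [where N = p]) simp_all
    qed
  next
    assume ?ii
    then obtain K where K: "n = 2 * K + 1" "odd (K + p)" using odd_n' by blast
    have n: "p + q = (if False then 2 * K else 2 * K + 1)" and d: "K = (if False then K - 1 else K)"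
      using K hn by simp_all
    note iso = clif_group_iso [where P = q and Q = p, OF _ _ n pos K(2) d]
    show ?C unfolding G2i1_eq half [OF K(1)]
    proof (intro conjI impI, goal_cases)
      case 1
      then show ?case by (intro iso(1) [where N = q]) simp_all
    next
      case 2
      then have "even K" using K(1) by (auto; presburger)
      then have "even q" "q < p + q" using K hn by presburger+
      with 2 show ?case by (intro iso(2) [where N = q]) simp_all
    next
      case 3
      then have "K mod 4 = 1" using K(1) by presburger
      then have "odd K" "odd ((K + 1) div 2)" by presburger+
      then show ?case by (intro iso(3) [where N = q]) simp_all
    next
      case 4
      then have "K mod 4 = 3" using K(1) by presburger
      then have "odd K" "even ((K + 1) div 2)" by presburger+
      then show ?case by (intro iso(4) [where N = q]) simp_all
    qed
    show ?D unfolding G2i3_eq half [OF K(1)]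
    proof (intro conjI impI, goal_cases)
      case 1
      then show ?case by (intro iso(1) [where N = p]) simp_all
    next
      case 2
      then have "odd K" using K(1) by (auto; presburger)
      then have "even p" "p < p + q" using K hn by presburger+
      with 2 show ?case by (intro iso(2) [where N = p]) simp_all
    next
      case 3
      then have "K mod 4 = 2" using K(1) by presburger
      then have "even K" "odd ((K + 1) div 2)" by presburger+
      then show ?case by (intro iso(3) [where N = p]) simp_all
    next
      case 4
      then have "K mod 4 = 0" using K(1) by presburger
      then have "even K" "even ((K + 1) div 2)" by presburger+
      then show ?case by (intro iso(4) [where N = p]) simp_all
    qed
  next
    assume ?iii
    then obtain K where K: "n = 2 * K" "odd (K + q)" using even_n by blast
    have n: "p + q = (if True then 2 * K else 2 * K + 1)" and d: "K - 1 = (if True then K - 1 else K)"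
      using K hn by simp_all
    note iso = clif_group_iso [where P = p and Q = q, OF _ _ n pos K(2) d]
    have G2: "G2 p q = clif_group p q 1 (blade_index (p + q) True) 1"
      "G2 p q = clif_group p q 1 (blade_index (p + q) True) (-1)"
      by (simp_all add: G2_eq)
    show ?E unfolding half' [OF K(1)]
    proof (intro conjI impI, goal_cases)
      case 1
      then show ?case
      proof
        assume "(p, q) = (n, 0)"
        then show ?case unfolding G2(1) by (intro iso(1) [where N = q]) simp_all
      next
        assume "(p, q) = (0, n)"
        then show ?case unfolding G2(2) by (intro iso(1) [where N = p]) simp_all
      qed
    next
      case 2
      then have "odd K" using K(1) by (auto; presburger)
      then have "even q" using K(2) by presburger
      with 2 show ?case unfolding G2(1) by (intro iso(2) [where N = q]) simp_all
    next
      case 3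
      then have "K mod 4 = 2" using K(1) by presburger
      then have "even K" "odd ((K + 1) div 2)" by presburger+
      then show ?case unfolding G2(1) by (intro iso(3) [where N = q]) simp_all
    next
      case 4
      then have "K mod 4 = 0" using K(1) by presburger
      then have "even K" "even ((K + 1) div 2)" by presburger+
      then show ?case unfolding G2(1) by (intro iso(4) [where N = q]) simp_all
    qed
  qed
qed

end
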